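(* Let $u$ be an inner function in the little Bloch space that is not a finite Blaschke product and let $\Omega$ be a connected component of $CN^{*}$. Then $|u|$ cannot be approximated uniformly in $\mathbb D$ by functions $|f|$ with $f\in\Omega$. In particular, $u$ does not belong to the closure (in $H^\infty$) of any connected component of $CN^{*}$.
   Context: $\mathbb D$ is the open unit disk. $H^\infty$ is the Banach algebra of bounded analytic functions on $\mathbb D$ with the sup norm; $(H^\infty)^{-1}$ is its group of invertible elements. An analytic function $f$ on $\mathbb D$ is in the little Bloch space if $\lim_{|z|\to1}(1-|z|^2)|f'(z)|=0$. Finite Blaschke products include unimodular constants. A complex measure $\mu$ on $\mathbb D$ is a Carleson measure if there is $C>0$ with $\int_{\mathbb D}|f|\,d|\mu|\le C\|f\|_1$ for all $f\in H^1$. A Carleson-Newman Blaschke product is a Blaschke product $b$ (with finitely many, possibly no, or infinitely many zeros) such that $\sum_{b(z)=0}(1-|z|)\delta_z$ (zeros counted with multiplicity) is a Carleson measure; equivalently, a finite product of interpolating Blaschke products. $CN^{*}$ is the (open) subset of $H^\infty$ of functions $bh$ with $b$ a Carleson-Newman Blaschke product and $h\in(H^\infty)^{-1}$. *)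

theory Defs
  imports "HOL-Complex_Analysis.Complex_Analysis"
begin

abbreviation unit_disc :: "complex set" where
  "unit_disc \<equiv> ball 0 1"

section \<open>The Banach algebra of bounded analytic functions on the disc\<close>

text \<open>
  HOL functions are total, so an element is represented by its extension by zero outside the disc;
  this makes equality in the type the same as equality on the disc.
\<close>

typedef hinf = "{f :: complex \<Rightarrow> complex. f holomorphic_on unit_disc \<and>
    bounded (f ` unit_disc) \<and> (\<forall>z. z \<notin> unit_disc \<longrightarrow> f z = 0)}"
  morphisms hinf_apply Abs_hinf
  by (rule exI[of _ "\<lambda>_. 0"]) (auto simp: bounded_iff)

setup_lifting type_definition_hinf

lemma hinf_holomorphic: "hinf_apply f holomorphic_on unit_disc"
  and hinf_bounded: "bounded (hinf_apply f ` unit_disc)"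
  and hinf_outside: "z \<notin> unit_disc \<Longrightarrow> hinf_apply f z = 0"
  using hinf_apply[of f] by auto

lemma hinf_eqI:
  assumes "\<And>z. z \<in> unit_disc \<Longrightarrow> hinf_apply f z = hinf_apply g z"
  shows "f = g"
  using assms hinf_outside by (metis ext hinf_apply_inject)

lemma bounded_image_mult:
  fixes f g :: "complex \<Rightarrow> complex"
  assumes "bounded (f ` S)" "bounded (g ` S)"
  shows "bounded ((\<lambda>z. f z * g z) ` S)"
proof -
  obtain a b where ab: "\<And>z. z \<in> S \<Longrightarrow> norm (f z) \<le> a" "\<And>z. z \<in> S \<Longrightarrow> norm (g z) \<le> b"
    using assms by (auto simp: bounded_iff)
  have "norm (f z * g z) \<le> a * b" if "z \<in> S" for z
    unfolding norm_mult using ab[OF that] norm_ge_zero order_trans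
    by (metis mult_mono)
  thus ?thesis by (auto simp: bounded_iff)
qed

instantiation hinf :: comm_ring_1
begin

lift_definition zero_hinf :: hinf is "\<lambda>_. 0" by (auto simp: bounded_iff)
lift_definition one_hinf :: hinf is "\<lambda>z. if z \<in> unit_disc then 1 else 0"
proof (intro conjI allI impI)
  show "(\<lambda>z. if z \<in> unit_disc then 1 else 0 :: complex) holomorphic_on unit_disc"
    by (rule holomorphic_transform[of "\<lambda>_. 1"]) simp_all
qed (auto simp: bounded_iff)
lift_definition plus_hinf :: "hinf \<Rightarrow> hinf \<Rightarrow> hinf" is "\<lambda>f g z. f z + g z"
  by (auto intro!: holomorphic_intros bounded_plus_comp)
lift_definition minus_hinf :: "hinf \<Rightarrow> hinf \<Rightarrow> hinf" is "\<lambda>f g z. f z - g z"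
  by (auto intro!: holomorphic_intros bounded_minus_comp)
lift_definition uminus_hinf :: "hinf \<Rightarrow> hinf" is "\<lambda>f z. - f z"
  by (auto intro!: holomorphic_intros simp: bounded_iff)
lift_definition times_hinf :: "hinf \<Rightarrow> hinf \<Rightarrow> hinf" is "\<lambda>f g z. f z * g z"
  by (auto intro!: holomorphic_intros bounded_image_mult)

lemma hinf_apply_ring [simp]:
  "hinf_apply 0 z = 0"
  "hinf_apply (f + g) z = hinf_apply f z + hinf_apply g z"
  "hinf_apply (f - g) z = hinf_apply f z - hinf_apply g z"
  "hinf_apply (- f) z = - hinf_apply f z"
  "hinf_apply (f * g) z = hinf_apply f z * hinf_apply g z"
  by (simp_all add: zero_hinf.rep_eq plus_hinf.rep_eq minus_hinf.rep_eq
      uminus_hinf.rep_eq times_hinf.rep_eq)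

lemma hinf_apply_one [simp]: "z \<in> unit_disc \<Longrightarrow> hinf_apply 1 z = 1"
  by (simp add: one_hinf.rep_eq)

instance
proof
  have "hinf_apply 0 0 \<noteq> hinf_apply 1 0" by simp
  thus "0 \<noteq> (1::hinf)" by metis
qed (rule hinf_eqI, simp add: algebra_simps)+

end

instantiation hinf :: real_vector
begin
lift_definition scaleR_hinf :: "real \<Rightarrow> hinf \<Rightarrow> hinf" is "\<lambda>c f z. c *\<^sub>R f z"
  by (auto simp: scaleR_conv_of_real intro!: holomorphic_intros bounded_image_mult)
     (auto simp: bounded_iff)

lemma hinf_apply_scaleR [simp]: "hinf_apply (c *\<^sub>R f) z = c *\<^sub>R hinf_apply f z"
  by (simp add: scaleR_hinf.rep_eq)

instance
  by standard (rule hinf_eqI, simp add: algebra_simps)+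

end

instantiation hinf :: real_normed_algebra_1
begin
definition norm_hinf :: "hinf \<Rightarrow> real" where
  "norm_hinf f = (SUP z\<in>unit_disc. norm (hinf_apply f z))"
definition dist_hinf :: "hinf \<Rightarrow> hinf \<Rightarrow> real" where
  "dist_hinf f g = norm (f - g)"
definition sgn_hinf :: "hinf \<Rightarrow> hinf" where
  "sgn_hinf f = f /\<^sub>R norm f"
definition uniformity_hinf :: "(hinf \<times> hinf) filter" where
  "uniformity_hinf = (INF e\<in>{0<..}. principal {(x, y). dist x y < e})"
definition open_hinf :: "hinf set \<Rightarrow> bool" where
  "open_hinf S \<longleftrightarrow> (\<forall>x\<in>S. \<forall>\<^sub>F (x', y) in uniformity. x' = x \<longrightarrow> y \<in> S)"

lemma norm_hinf_upper:
  assumes "z \<in> unit_disc"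
  shows "norm (hinf_apply f z) \<le> norm f"
  unfolding norm_hinf_def
proof (rule cSUP_upper[OF assms])
  show "bdd_above ((\<lambda>z. norm (hinf_apply f z)) ` unit_disc)"
    using hinf_bounded[of f] by (auto simp: bounded_iff bdd_above_def)
qed

lemma norm_hinf_least:
  assumes "\<And>z. z \<in> unit_disc \<Longrightarrow> norm (hinf_apply f z) \<le> B"
  shows "norm f \<le> B"
  unfolding norm_hinf_def by (rule cSUP_least) (use assms in auto)

lemma norm_hinf_nonneg: "0 \<le> norm (f :: hinf)"
  using norm_hinf_upper[of 0 f] norm_ge_zero[of "hinf_apply f 0"] by (simp del: norm_ge_zero)

instance
proof
  fix f g :: hinf and c :: real
  show "norm f = 0 \<longleftrightarrow> f = 0"
  proof
    assume "norm f = 0"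
    thus "f = 0" using norm_hinf_upper[of _ f] by (intro hinf_eqI) simp
  next
    assume "f = 0"
    thus "norm f = 0" using norm_hinf_nonneg[of f] norm_hinf_least[of f 0] by simp
  qed
  show "norm (f + g) \<le> norm f + norm g"
  proof (rule norm_hinf_least)
    fix z assume z: "z \<in> unit_disc"
    show "norm (hinf_apply (f + g) z) \<le> norm f + norm g"
      using norm_triangle_ineq[of "hinf_apply f z" "hinf_apply g z"]
        norm_hinf_upper[OF z, of f] norm_hinf_upper[OF z, of g] by simp
  qed
  have le: "norm (c *\<^sub>R f) \<le> \<bar>c\<bar> * norm f" for c :: real and f :: hinf
    by (rule norm_hinf_least) (auto intro!: mult_left_mono norm_hinf_upper)
  show "norm (c *\<^sub>R f) = \<bar>c\<bar> * norm f"
  proof (cases "c = 0")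
    case True
    thus ?thesis using le[of 0 f] norm_hinf_nonneg[of "0 *\<^sub>R f"] by simp
  next
    case False
    hence "norm f \<le> \<bar>inverse c\<bar> * norm (c *\<^sub>R f)"
      using le[of "inverse c" "c *\<^sub>R f"] by simp
    thus ?thesis using le[of c f] False by (simp add: field_simps)
  qed
  show "norm (f * g) \<le> norm f * norm g"
    by (rule norm_hinf_least)
      (auto simp: norm_mult intro!: mult_mono norm_hinf_upper norm_hinf_nonneg)
  show "norm (1 :: hinf) = 1"
    using norm_hinf_upper[of 0 1] norm_hinf_least[of 1 1] by simp
  show "c *\<^sub>R f * g = c *\<^sub>R (f * g)" "f * c *\<^sub>R g = c *\<^sub>R (f * g)"
    by (auto intro!: hinf_eqI)
qed (rule dist_hinf_def sgn_hinf_def uniformity_hinf_def open_hinf_def)+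
end

instance hinf :: banach
proof
  fix X :: "nat \<Rightarrow> hinf"
  assume X: "Cauchy X"
  have unif: "uniformly_Cauchy_on unit_disc (\<lambda>n. hinf_apply (X n))"
    unfolding uniformly_Cauchy_on_def
  proof (intro allI impI)
    fix e :: real assume "e > 0"
    then obtain M where M: "\<And>m n. m \<ge> M \<Longrightarrow> n \<ge> M \<Longrightarrow> norm (X m - X n) < e"
      using X unfolding Cauchy_def dist_norm by meson
    show "\<exists>M. \<forall>z\<in>unit_disc. \<forall>m\<ge>M. \<forall>n\<ge>M. dist (hinf_apply (X m) z) (hinf_apply (X n) z) < e"
    proof (intro exI ballI allI impI)
      fix z m n assume z: "z \<in> unit_disc" "m \<ge> M" "n \<ge> M"
      show "dist (hinf_apply (X m) z) (hinf_apply (X n) z) < e"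
        using norm_hinf_upper[OF z(1), of "X m - X n"] M[OF z(2,3)] by (simp add: dist_norm)
    qed
  qed
  then obtain l where l: "uniform_limit unit_disc (\<lambda>n. hinf_apply (X n)) l sequentially"
    using Cauchy_uniformly_convergent uniformly_convergent_on_def by blast
  have hol: "l holomorphic_on unit_disc"
  proof (rule holomorphic_uniform_sequence[where f = "\<lambda>n. hinf_apply (X n)"])
    fix x :: complex assume "x \<in> unit_disc"
    then obtain d where "d > 0" "cball x d \<subseteq> unit_disc"
      using open_contains_cball[of unit_disc] open_ball by meson
    thus "\<exists>d>0. cball x d \<subseteq> unit_disc \<and>
        uniform_limit (cball x d) (\<lambda>n. hinf_apply (X n)) l sequentially"
      using uniform_limit_on_subset[OF l] by blast
  qed (auto simp: hinf_holomorphic)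
  have bdd: "bounded (l ` unit_disc)"
  proof -
    obtain N where N: "\<And>z. z \<in> unit_disc \<Longrightarrow> dist (hinf_apply (X N) z) (l z) < 1"
      using uniform_limitD[OF l, of 1] unfolding eventually_sequentially
      by (meson order_refl zero_less_one)
    have "norm (l z) \<le> norm (X N) + 1" if "z \<in> unit_disc" for z
      using N[OF that] norm_hinf_upper[OF that, of "X N"]
        norm_triangle_ineq2[of "l z" "hinf_apply (X N) z"]
      by (simp add: dist_norm norm_minus_commute)
    thus ?thesis by (intro boundedI[of _ "norm (X N) + 1"]) auto
  qed
  define L where "L = Abs_hinf (\<lambda>z. if z \<in> unit_disc then l z else 0)"
  have L: "hinf_apply L z = l z" if "z \<in> unit_disc" for z
    using that hol bdd unfolding L_def
    by (subst Abs_hinf_inverse) (auto intro: holomorphic_transform[OF hol] simp: bounded_iff)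
  have "X \<longlonglongrightarrow> L"
  proof (rule LIMSEQ_I)
    fix e :: real assume "e > 0"
    then obtain N where N: "\<And>n z. n \<ge> N \<Longrightarrow> z \<in> unit_disc \<Longrightarrow> dist (hinf_apply (X n) z) (l z) < e / 2"
      using uniform_limitD[OF l, of "e / 2"] unfolding eventually_sequentially
      by (meson half_gt_zero)
    have "norm (X n - L) \<le> e / 2" if "n \<ge> N" for n
      by (rule norm_hinf_least) (use N[OF that] L in \<open>auto simp: dist_norm less_imp_le\<close>)
    thus "\<exists>N. \<forall>n\<ge>N. norm (X n - L) < e"
      using \<open>e > 0\<close> by (intro exI[of _ N]) fastforce
  qed
  thus "convergent X" by (rule convergentI)
qed

section \<open>Inner functions and the little Bloch space\<close>

definition inner_function :: "(complex \<Rightarrow> complex) \<Rightarrow> bool" where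
  "inner_function f \<longleftrightarrow> f holomorphic_on unit_disc \<and> bounded (f ` unit_disc) \<and>
     (AE t in lebesgue_on {0..2 * pi}.
        \<exists>w. norm w = 1 \<and> ((\<lambda>r. f (of_real r * cis t)) \<longlongrightarrow> w) (at_left 1))"

definition little_bloch :: "(complex \<Rightarrow> complex) \<Rightarrow> bool" where
  "little_bloch f \<longleftrightarrow> f holomorphic_on unit_disc \<and>
     ((\<lambda>z. (1 - (norm z)\<^sup>2) * norm (deriv f z)) \<longlongrightarrow> 0) (filtercomap norm (at_left 1))"

section \<open>Blaschke products\<close>

definition blaschke_factor :: "complex \<Rightarrow> complex \<Rightarrow> complex" where
  "blaschke_factor a z =
     (if a = 0 then z else (of_real (norm a) / a) * ((a - z) / (1 - cnj a * z)))"

definition finite_blaschke_product :: "(complex \<Rightarrow> complex) \<Rightarrow> bool" where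
  "finite_blaschke_product b \<longleftrightarrow>
     (\<exists>c (n::nat) a. norm c = 1 \<and> (\<forall>k<n. a k \<in> unit_disc) \<and>
        (\<forall>z\<in>unit_disc. b z = c * (\<Prod>k<n. blaschke_factor (a k) z)))"

definition infinite_blaschke_product :: "(complex \<Rightarrow> complex) \<Rightarrow> bool" where
  "infinite_blaschke_product b \<longleftrightarrow>
     (\<exists>c (a :: nat \<Rightarrow> complex). norm c = 1 \<and> (\<forall>k. a k \<in> unit_disc) \<and>
        summable (\<lambda>k. 1 - norm (a k)) \<and>
        (\<forall>z\<in>unit_disc. b z = c * (\<Prod>k. blaschke_factor (a k) z)))"

definition blaschke_product :: "(complex \<Rightarrow> complex) \<Rightarrow> bool" where
  "blaschke_product b \<longleftrightarrow> finite_blaschke_product b \<or> infinite_blaschke_product b"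

section \<open>Carleson measures\<close>

definition hardy_mean :: "(complex \<Rightarrow> complex) \<Rightarrow> real \<Rightarrow> real" where
  "hardy_mean f r = integral {0..2 * pi} (\<lambda>t. norm (f (of_real r * cis t))) / (2 * pi)"

definition hardy1 :: "(complex \<Rightarrow> complex) set" where
  "hardy1 = {f. f holomorphic_on unit_disc \<and> bdd_above (hardy_mean f ` {0..<1})}"

definition hardy1_norm :: "(complex \<Rightarrow> complex) \<Rightarrow> real" where
  "hardy1_norm f = (SUP r\<in>{0..<1}. hardy_mean f r)"

text \<open>
  The Carleson condition on a complex measure involves only its total variation, so it is stated
  for positive Borel measures on the disc. Finiteness is the case \<open>f = 1\<close> of the condition.
\<close>

definition carleson_measure :: "complex measure \<Rightarrow> bool" where
  "carleson_measure M \<longleftrightarrow> sets M = sets (restrict_space borel unit_disc) \<and>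
     (\<exists>C>0. \<forall>f\<in>hardy1. (\<integral>\<^sup>+ z. ennreal (norm (f z)) \<partial>M) \<le> ennreal (C * hardy1_norm f))"

text \<open>
  The sum of \<open>(1 - |z|) \<delta>\<^sub>z\<close> over the zeros of \<open>b\<close> in the disc, counted with multiplicity,
  as a Borel measure on the disc. It is only used for \<open>b\<close> analytic and not identically zero,
  where \<open>zorder\<close> is the multiplicity of a zero.
\<close>

definition zero_measure :: "(complex \<Rightarrow> complex) \<Rightarrow> complex measure" where
  "zero_measure b =
     distr (density (count_space {z \<in> unit_disc. b z = 0})
              (\<lambda>z. ennreal (of_int (zorder b z) * (1 - norm z))))
       (restrict_space borel unit_disc) (\<lambda>z. z)"

definition carleson_newman :: "(complex \<Rightarrow> complex) \<Rightarrow> bool" where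
  "carleson_newman b \<longleftrightarrow> blaschke_product b \<and> carleson_measure (zero_measure b)"

definition CNstar :: "hinf set" where
  "CNstar = {b * h | b h. carleson_newman (hinf_apply b) \<and> h dvd 1}"

end

theory Submission
  imports Defs
begin

text \<open>
  Suppose \<open>|u|\<close> were approximable from \<open>\<Omega>\<close>. Two nearby functions of \<open>CNstar\<close> have zeros within
  bounded hyperbolic distance of each other, and \<open>u\<close>, being in the little Bloch space, is almost
  constant on hyperbolic discs near the circle. Hence the upper limit of \<open>|u|\<close> along the zeros is
  constant on \<open>\<Omega>\<close>, and it is 0 because better and better approximants have their zeros where
  \<open>|u|\<close> is smaller and smaller.

  Now fix one \<open>f \<in> \<Omega>\<close> with \<open>|f|\<close> within 1/16 of \<open>|u|\<close>. Away from its zeros \<open>|f| \<ge> \<delta>\<close>, so for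
  every \<open>c > 0\<close> the bound \<open>|f| \<ge> \<delta>\<close> holds on \<open>{c < |u| < 1/2}\<close> near the circle, where \<open>log |f|\<close> is
  harmonic. Since \<open>u\<close> is inner, the unit circle has harmonic measure zero as seen from this set, and
  \<open>log |u|\<close> shows that a Brownian path started where \<open>|u| = 1/8\<close> leaves it through \<open>|u| = 1/2\<close> with
  probability tending to 1 as \<open>c\<close> tends to 0. So \<open>log |f|\<close> at such a point is not much below
  \<open>log (7/16)\<close>, contradicting \<open>|f| \<le> 3/16\<close>. Such points exist arbitrarily close to the circle
  because \<open>u\<close> is not a finite Blaschke product.
\<close>

section \<open>Mean values on circles, and zeros forced by the minimum modulus principle\<close>

lemma circle_mean_value:
  assumes "g holomorphic_on ball 0 R" "0 \<le> r" "r < R"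
  shows "((\<lambda>t. g (of_real r * cis t)) has_integral of_real (2 * pi) * g 0) {0..2 * pi}"
proof (cases "r = 0")
  case True
  then show ?thesis
    using has_integral_const_real[of "g 0" 0 "2 * pi"] by (simp add: scaleR_conv_of_real)
next
  case False
  with assms have r: "0 < r" by simp
  have sub: "cball 0 r \<subseteq> ball (0::complex) R"
    using assms by auto
  have "((\<lambda>u. g u / (u - 0)) has_contour_integral (2 * of_real pi * \<i> * g 0)) (circlepath 0 r)"
    by (rule Cauchy_integral_circlepath_simple)
       (use assms r sub in \<open>auto intro: holomorphic_on_subset\<close>)
  then have "((\<lambda>t. g (0 + r * cis t) / (r * cis t) * r * \<i> * cis t) has_integral
      (2 * of_real pi * \<i> * g 0)) {0..2 * pi}"
    using has_contour_integral_part_circlepath_iff[of 0 "2 * pi" "\<lambda>u. g u / (u - 0)" _ 0 r]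
    by (simp add: circlepath_def)
  then have "((\<lambda>t. g (r * cis t) * \<i>) has_integral (2 * of_real pi * \<i> * g 0)) {0..2 * pi}"
    by (rule has_integral_eq[rotated]) (use r in auto)
  then have "((\<lambda>t. (g (r * cis t) * \<i>) * (- \<i>)) has_integral
      (2 * of_real pi * \<i> * g 0) * (- \<i>)) {0..2 * pi}"
    by (rule has_integral_mult_left)
  moreover have "2 * of_real pi * \<i> * g 0 * (- \<i>) = of_real (2 * pi) * g 0"
    by (simp add: complex_eq_iff)
  moreover have "(g (r * cis t) * \<i>) * (- \<i>) = g (r * cis t)" for t
    by (simp add: mult.assoc)
  ultimately show ?thesis by (simp only:)
qed

lemma circle_mean_value_Re:
  assumes "g holomorphic_on ball 0 R" "0 \<le> r" "r < R"
  shows "((\<lambda>t. Re (g (of_real r * cis t))) has_integral 2 * pi * Re (g 0)) {0..2 * pi}"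
  using has_integral_linear[OF circle_mean_value[OF assms] bounded_linear_Re] by (simp add: o_def)

text \<open>Without a zero in the disc, the maximum principle for \<open>1 / f\<close> would bound
  it by \<open>1 / d\<close> at the centre, against \<open>norm (f a) < d\<close>.\<close>

lemma min_modulus_zero:
  assumes hol: "f holomorphic_on ball 0 1" and a: "cball a s \<subseteq> ball 0 1" and s: "s > 0"
    and d: "d > 0" and sph: "\<And>z. norm (z - a) = s \<Longrightarrow> d \<le> norm (f z)"
    and fa: "norm (f a) < d"
  obtains b where "norm (b - a) < s" "f b = 0"
proof (rule ccontr)
  assume "\<not> thesis"
  with that have nz: "\<And>z. norm (z - a) < s \<Longrightarrow> f z \<noteq> 0" by blast
  have nz': "f z \<noteq> 0" if "z \<in> cball a s" for z
  proof (cases "norm (z - a) = s")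
    case True with sph[OF True] d show ?thesis by auto
  next
    case False with that nz[of z] show ?thesis
      by (auto simp: dist_norm norm_minus_commute)
  qed
  have hol': "(\<lambda>z. 1 / f z) holomorphic_on cball a s"
    by (intro holomorphic_intros holomorphic_on_subset[OF hol a]) (use nz' in auto)
  have "norm (1 / f a) \<le> 1 / d"
  proof (rule maximum_modulus_frontier[where S = "ball a s" and f = "\<lambda>z. 1 / f z"])
    show "(\<lambda>z. 1 / f z) holomorphic_on interior (ball a s)"
      using hol' holomorphic_on_subset by fastforce
    show "continuous_on (closure (ball a s)) (\<lambda>z. 1 / f z)"
      using hol' s by (simp add: holomorphic_on_imp_continuous_on)
    fix z assume "z \<in> frontier (ball a s)"
    then have "norm (z - a) = s"
      using s by (simp add: dist_norm norm_minus_commute)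
    from sph[OF this] d show "norm (1 / f z) \<le> 1 / d"
      by (simp add: norm_divide frac_le)
  qed (use s in auto)
  then show False
    using fa d nz'[of a] s by (auto simp: norm_divide field_simps)
qed

section \<open>A maximum principle with radial boundary values\<close>

text \<open>Only the consequences of subharmonicity that follow from the existence of a
  local harmonic minorant touching at the centre are used.\<close>

definition touching_subharmonic :: "complex set \<Rightarrow> (complex \<Rightarrow> real) \<Rightarrow> bool" where
  "touching_subharmonic U S \<longleftrightarrow> continuous_on U S \<and>
     (\<forall>z\<in>U. \<exists>r>0. \<exists>g. g holomorphic_on ball z r \<and> ball z r \<subseteq> U \<and> Re (g z) = S z \<and>
        (\<forall>w\<in>ball z r. Re (g w) \<le> S w))"

lemma touching_subharmonic_eq:
  assumes S: "touching_subharmonic U S" and eq: "\<And>z. z \<in> U \<Longrightarrow> S z = T z"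
  shows "touching_subharmonic U T"
  unfolding touching_subharmonic_def
proof (intro conjI ballI)
  show "continuous_on U T"
    using S eq unfolding touching_subharmonic_def by (metis continuous_on_cong)
  fix z assume z: "z \<in> U"
  then obtain r g where "r > 0" "g holomorphic_on ball z r" "ball z r \<subseteq> U" "Re (g z) = S z"
    "\<forall>w\<in>ball z r. Re (g w) \<le> S w"
    using S unfolding touching_subharmonic_def by blast
  then show "\<exists>r>0. \<exists>g. g holomorphic_on ball z r \<and> ball z r \<subseteq> U \<and> Re (g z) = T z \<and>
      (\<forall>w\<in>ball z r. Re (g w) \<le> T w)"
    using eq z by (intro exI[of _ r] conjI exI[of _ g]) (auto simp: subset_iff)
qed

text \<open>Off \<open>W\<close> the constant 0 serves as touching minorant, since \<open>S\<close>
  is nonnegative and vanishes there. This permits extension by zero from a region of the disc to the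
  whole disc.\<close>

lemma touching_subharmonic_glue:
  assumes S: "\<And>z. z \<in> U \<Longrightarrow> z \<notin> W \<Longrightarrow> S z = 0" and pos: "\<And>z. z \<in> U \<Longrightarrow> 0 \<le> S z"
    and cont: "continuous_on U S" and W: "touching_subharmonic W S" "W \<subseteq> U" and U: "open U"
  shows "touching_subharmonic U S"
  unfolding touching_subharmonic_def
proof (intro conjI ballI cont)
  fix z assume z: "z \<in> U"
  show "\<exists>r>0. \<exists>g. g holomorphic_on ball z r \<and> ball z r \<subseteq> U \<and> Re (g z) = S z \<and>
      (\<forall>w\<in>ball z r. Re (g w) \<le> S w)"
  proof (cases "z \<in> W")
    case True
    then obtain r g where "r > 0" "g holomorphic_on ball z r" "ball z r \<subseteq> W" "Re (g z) = S z"
      "\<forall>w\<in>ball z r. Re (g w) \<le> S w"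
      using W(1) unfolding touching_subharmonic_def by blast
    then show ?thesis using W(2) by blast
  next
    case False
    obtain r where "r > 0" "ball z r \<subseteq> U" using U z open_contains_ball by blast
    then show ?thesis using S[OF z False] pos
      by (intro exI[of _ r] conjI exI[of _ "\<lambda>_. 0"]) (auto simp: subset_iff)
  qed
qed

text \<open>Where \<open>norm (f z) > 1\<close>, rotating \<open>f\<close> by the conjugate phase of
  \<open>f z\<close> gives a function whose real part touches the modulus at \<open>z\<close> and
  stays below it nearby; elsewhere the constant 0 touches.\<close>

lemma touching_subharmonic_max_norm:
  assumes "f holomorphic_on U" "open U"
  shows "touching_subharmonic U (\<lambda>z. max 1 (norm (f z)) - 1)"
  unfolding touching_subharmonic_def
proof (intro conjI ballI)
  show "continuous_on U (\<lambda>z. max 1 (norm (f z)) - 1)"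
    by (intro continuous_intros holomorphic_on_imp_continuous_on assms)
  fix z assume "z \<in> U"
  then obtain r where r: "r > 0" "ball z r \<subseteq> U" using assms(2) open_contains_ball by blast
  define g where "g = (if norm (f z) \<le> 1 then (\<lambda>w. 0) else (\<lambda>w. cnj (sgn (f z)) * f w - 1))"
  have "g holomorphic_on ball z r"
    unfolding g_def by (auto intro!: holomorphic_intros holomorphic_on_subset[OF assms(1) r(2)])
  moreover have "Re (g z) = max 1 (norm (f z)) - 1"
  proof (cases "norm (f z) \<le> 1")
    case False
    have "f z \<noteq> 0" using False by auto
    have "cnj (sgn (f z)) * f z = f z * cnj (f z) / of_real (norm (f z))"
      by (simp add: sgn_eq)
    also have "\<dots> = of_real (norm (f z))"
      using \<open>f z \<noteq> 0\<close> by (simp add: power2_eq_square flip: complex_norm_square)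
    finally have "cnj (sgn (f z)) * f z = of_real (norm (f z))" .
    then show ?thesis using False by (simp add: g_def)
  qed (simp add: g_def)
  moreover have "Re (g w) \<le> max 1 (norm (f w)) - 1" for w
  proof (cases "norm (f z) \<le> 1")
    case False
    have "Re (cnj (sgn (f z)) * f w) \<le> norm (cnj (sgn (f z)) * f w)" by (rule complex_Re_le_cmod)
    also have "\<dots> \<le> norm (f w)" by (simp add: norm_mult norm_sgn)
    finally show ?thesis using False by (simp add: g_def)
  qed (simp add: g_def)
  ultimately show "\<exists>r>0. \<exists>g. g holomorphic_on ball z r \<and> ball z r \<subseteq> U \<and>
      Re (g z) = max 1 (norm (f z)) - 1 \<and> (\<forall>w\<in>ball z r. Re (g w) \<le> max 1 (norm (f w)) - 1)"
    using r by blast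
qed

text \<open>Among the points where \<open>S - Re p\<close> is maximal, one farthest from the origin
  is chosen. The minorant touching there forces maximality on a whole neighbourhood, which contains
  points still farther out.\<close>

lemma touching_subharmonic_maximum:
  assumes S: "touching_subharmonic (ball 0 R) S" and p: "p holomorphic_on ball 0 R"
    and r: "0 < r" "r < R" and bd: "\<And>z. norm z = r \<Longrightarrow> S z \<le> Re (p z)"
    and x: "norm x \<le> r"
  shows "S x \<le> Re (p x)"
proof (rule ccontr)
  assume neg: "\<not> S x \<le> Re (p x)"
  define D where "D = (\<lambda>z. S z - Re (p z))"
  have sub: "cball 0 r \<subseteq> ball (0::complex) R" using r by auto
  have cont: "continuous_on (cball 0 r) D"
    unfolding D_def
    using S p sub by (auto simp: touching_subharmonic_def
        intro!: continuous_intros holomorphic_on_imp_continuous_on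
        intro: continuous_on_subset holomorphic_on_subset)
  obtain y where y: "y \<in> cball 0 r" "\<And>z. z \<in> cball 0 r \<Longrightarrow> D z \<le> D y"
    using continuous_attains_sup[OF _ _ cont] r by (metis cball_eq_empty compact_cball not_less_iff_gr_or_eq)
  define X where "X = {z \<in> cball 0 r. D z = D y}"
  have "compact X"
  proof -
    have "closed X" unfolding X_def
      using continuous_closed_preimage_constant[OF cont] by simp
    then show ?thesis unfolding X_def
      by (metis (no_types, lifting) bounded_cball bounded_subset compact_eq_bounded_closed mem_Collect_eq subsetI)
  qed
  moreover have "X \<noteq> {}" using y by (auto simp: X_def)
  ultimately obtain w where w: "w \<in> X" "\<And>z. z \<in> X \<Longrightarrow> norm z \<le> norm w"
    using continuous_attains_sup[of X norm] by (metis continuous_on_norm_id)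
  have pos: "D w > 0"
    using y(2)[of x] x neg w by (auto simp: X_def D_def)
  have wr: "norm w < r"
    using w(1) pos bd[of w] by (auto simp: X_def D_def order_less_le)
  obtain e g where e: "e > 0" and g: "g holomorphic_on ball w e" "ball w e \<subseteq> ball 0 R"
    "Re (g w) = S w" "\<And>z. z \<in> ball w e \<Longrightarrow> Re (g z) \<le> S z"
    using S wr r unfolding touching_subharmonic_def
    by (smt (verit, ccfv_SIG) dist_0_norm mem_ball)
  define e' where "e' = min e (r - norm w)"
  have e': "e' > 0" using e wr by (simp add: e'_def)
  have sub': "ball w e' \<subseteq> cball 0 r" "ball w e' \<subseteq> ball w e"
  proof
    fix z assume "z \<in> ball w e'"
    then have "norm (z - w) < r - norm w"
      by (auto simp: e'_def dist_norm norm_minus_commute)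
    then show "z \<in> cball 0 r"
      using norm_triangle_ineq2[of z w] by simp
  qed (auto simp: e'_def)
  \<comment> \<open>The exponential turns a maximum of the harmonic function
    \<open>Re (g - p)\<close> into a maximum of the modulus of a holomorphic function.\<close>
  have "(\<lambda>z. exp (g z - p z)) constant_on ball w e'"
  proof (rule maximum_modulus_principle[where U = "ball w e'" and \<xi> = w])
    show "(\<lambda>z. exp (g z - p z)) holomorphic_on ball w e'"
      by (intro holomorphic_intros holomorphic_on_subset[OF g(1)] holomorphic_on_subset[OF p])
         (use sub' sub in auto)
    fix z assume z: "z \<in> ball w e'"
    have "Re (g z) - Re (p z) \<le> D z" using g(4)[of z] z sub' by (auto simp: D_def)
    also have "\<dots> \<le> D w" using y(2) w(1) z sub'(1) by (auto simp: X_def)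
    also have "\<dots> = Re (g w) - Re (p w)" using g by (simp add: D_def)
    finally show "cmod (exp (g z - p z)) \<le> cmod (exp (g w - p w))"
      by simp
  qed (use e' in auto)
  then have eq: "Re (g z) - Re (p z) = Re (g w) - Re (p w)" if "z \<in> ball w e'" for z
  proof -
    from \<open>(\<lambda>z. exp (g z - p z)) constant_on ball w e'\<close> have "exp (g z - p z) = exp (g w - p w)"
      using that e' unfolding constant_on_def by force
    then have "exp (Re (g z - p z)) = exp (Re (g w - p w))"
      by (metis norm_exp_eq_Re)
    then show ?thesis by simp
  qed
  define q where "q = w + (if w = 0 then of_real (e' / 2) else of_real (e' / 2) * sgn w)"
  have q: "q \<in> ball w e'"
    using e' by (auto simp: q_def dist_norm norm_mult norm_sgn)
  have qn: "norm q > norm w"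
  proof (cases "w = 0")
    case False
    have "q = of_real (1 + e' / 2 / norm w) * w"
      using False by (simp add: q_def sgn_eq algebra_simps)
    then have "norm q = \<bar>1 + e' / 2 / norm w\<bar> * norm w" by (metis norm_mult norm_of_real)
    also have "\<dots> = norm w + e' / 2" using False e' by (simp add: algebra_simps add_nonneg_nonneg)
    finally show ?thesis using e' by simp
  qed (use e' in \<open>simp add: q_def\<close>)
  have "D q \<ge> Re (g q) - Re (p q)" using g(4)[of q] q sub' by (auto simp: D_def)
  with eq[OF q] g(3) have "D q \<ge> D w" by (simp add: D_def)
  with y(2)[of q] w(1) q sub' have "q \<in> X" by (auto simp: X_def)
  with w(2) qn show False by fastforce
qed

section \<open>Approximate solution of the Dirichlet problem on a circle\<close>

lemma circle_trig_Re:
  assumes "r \<ge> 0"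
  shows "\<exists>P. \<forall>z::complex. norm z = r \<longrightarrow> Re (c * z ^ j * cnj z ^ k) = Re (poly P z)"
proof (cases "k \<le> j")
  case True
  show ?thesis
  proof (rule exI[of _ "monom (c * of_real (r ^ (2 * k))) (j - k)"], intro allI impI)
    fix z :: complex assume z: "norm z = r"
    \<comment> \<open>On the circle \<open>z * cnj z\<close> is the constant \<open>r ^ 2\<close>,
      so only a pure power of \<open>z\<close> survives.\<close>
    have "z ^ j * cnj z ^ k = z ^ (j - k) * (z * cnj z) ^ k"
      using True by (simp add: power_mult_distrib flip: power_add mult.assoc)
    also have "z * cnj z = of_real (r ^ 2)"
      using z by (metis complex_norm_square)
    finally have "z ^ j * cnj z ^ k = z ^ (j - k) * of_real (r ^ (2 * k))"
      by (simp add: power_mult)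
    then show "Re (c * z ^ j * cnj z ^ k) =
        Re (poly (monom (c * of_real (r ^ (2 * k))) (j - k)) z)"
      by (simp add: poly_monom mult_ac)
  qed
next
  case False
  show ?thesis
  proof (rule exI[of _ "monom (cnj c * of_real (r ^ (2 * j))) (k - j)"], intro allI impI)
    fix z :: complex assume z: "norm z = r"
    \<comment> \<open>Here the surplus power is one of \<open>cnj z\<close>; conjugation makes it a
      power of \<open>z\<close> and keeps the real part.\<close>
    have "cnj (c * z ^ j * cnj z ^ k) = cnj c * (z ^ (k - j) * (z * cnj z) ^ j)"
      using False by (simp add: power_mult_distrib mult_ac flip: power_add)
    also have "z * cnj z = of_real (r ^ 2)"
      using z by (metis complex_norm_square)
    finally have "cnj (c * z ^ j * cnj z ^ k) = cnj c * (z ^ (k - j) * of_real (r ^ (2 * j)))"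
      by (simp add: power_mult)
    then have "cnj (c * z ^ j * cnj z ^ k) = poly (monom (cnj c * of_real (r ^ (2 * j))) (k - j)) z"
      unfolding poly_monom by (simp only: mult_ac)
    then show "Re (c * z ^ j * cnj z ^ k) =
        Re (poly (monom (cnj c * of_real (r ^ (2 * j))) (k - j)) z)"
      by (metis cnj.sel(1))
  qed
qed

lemma circle_Re_poly_sum:
  assumes "finite I" "\<And>i. i \<in> I \<Longrightarrow> \<exists>P. \<forall>z::complex. norm z = r \<longrightarrow> h i z = Re (poly P z)"
  shows "\<exists>P. \<forall>z. norm z = r \<longrightarrow> (\<Sum>i\<in>I. h i z) = Re (poly P z)"
proof -
  obtain P where P: "\<And>i z. i \<in> I \<Longrightarrow> norm z = r \<Longrightarrow> h i z = Re (poly (P i) z)"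
    using assms(2) by metis
  show ?thesis
    by (rule exI[of _ "\<Sum>i\<in>I. P i"]) (auto simp: P poly_sum)
qed

text \<open>The mixed term that arises when two real parts are multiplied:
  \<open>Re A * Re B\<close> is half of \<open>Re (A * B) + Re (A * cnj B)\<close>.\<close>

lemma circle_Re_poly_cross:
  assumes "r \<ge> 0"
  shows "\<exists>P. \<forall>z::complex. norm z = r \<longrightarrow> Re (poly A z * cnj (poly B z)) = Re (poly P z)"
proof -
  have eq: "Re (poly A z * cnj (poly B z)) =
    (\<Sum>i\<in>{..degree A} \<times> {..degree B}.
       Re (coeff A (fst i) * cnj (coeff B (snd i)) * z ^ fst i * cnj z ^ snd i))" for z
    by (simp add: poly_altdef sum_product sum.cartesian_product mult_ac case_prod_unfold)
  show ?thesis
    unfolding eq by (intro circle_Re_poly_sum circle_trig_Re[OF assms]) auto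
qed

text \<open>Together with the Stone-Weierstrass theorem this approximates continuous functions on
  the circle by boundary values of harmonic polynomials, which replaces Poisson integrals.\<close>

lemma circle_real_polynomial_function:
  assumes "real_polynomial_function g" "r \<ge> 0"
  shows "\<exists>P. \<forall>z::complex. norm z = r \<longrightarrow> g z = Re (poly P z)"
  using assms(1)
proof (induction rule: real_polynomial_function.induct)
  case (linear f)
  interpret bounded_linear f by fact
  have "f z = Re (poly [:0, Complex (f 1) (- f \<i>):] z)" for z
  proof -
    have "z = Re z *\<^sub>R 1 + Im z *\<^sub>R \<i>" by (simp add: complex_eq_iff)
    then have "f z = Re z * f 1 + Im z * f \<i>" by (metis add scaleR real_scaleR_def)
    then show ?thesis by (simp add: algebra_simps)
  qed
  then show ?case by blast
next
  case (const c)
  show ?case by (rule exI[of _ "[:of_real c:]"]) simp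
next
  case (add f g)
  then obtain A B where "\<And>z. norm z = r \<Longrightarrow> f z = Re (poly A z)"
    "\<And>z. norm z = r \<Longrightarrow> g z = Re (poly B z)" by blast
  then show ?case by (intro exI[of _ "A + B"]) simp
next
  case (mult f g)
  then obtain A B where AB: "\<And>z. norm z = r \<Longrightarrow> f z = Re (poly A z)"
    "\<And>z. norm z = r \<Longrightarrow> g z = Re (poly B z)" by blast
  obtain C where C: "\<And>z. norm z = r \<Longrightarrow> Re (poly A z * cnj (poly B z)) = Re (poly C z)"
    using circle_Re_poly_cross[OF assms(2)] by blast
  have "f z * g z = Re (poly (smult (1/2) (A * B + C)) z)" if "norm z = r" for z
  proof -
    have "Re (poly (smult (1/2) (A * B + C)) z) =
        (Re (poly A z * poly B z) + Re (poly A z * cnj (poly B z))) / 2"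
      using C[OF that] by simp
    also have "\<dots> = Re (poly A z) * Re (poly B z)" by (simp add: field_simps)
    finally show ?thesis using AB that by simp
  qed
  then show ?case by blast
qed

text \<open>Harnack's inequality, from the Schwarz lemma applied to a Cayley transform of
  \<open>p\<close>.\<close>

lemma harnack:
  assumes p: "p holomorphic_on ball 0 r" and pos: "\<And>z. norm z < r \<Longrightarrow> 0 \<le> Re (p z)"
    and x: "norm x < r"
  shows "Re (p x) \<le> (r + norm x) / (r - norm x) * Re (p 0)"
proof -
  have r: "r > 0" using x by (meson norm_ge_zero order_le_less_trans)
  \<comment> \<open>Adding \<open>e\<close> makes the real part strictly positive, as the Cayley
    transform requires; \<open>e\<close> is removed at the end.\<close>
  have *: "Re (p x) + e \<le> (r + norm x) / (r - norm x) * (Re (p 0) + e)" if e: "e > 0" for e :: real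
  proof -
    define P where "P = (\<lambda>w. p (of_real r * w) - \<i> * of_real (Im (p 0)) + of_real e)"
    define c where "c = Re (p 0) + e"
    have P0: "P 0 = of_real c" by (simp add: P_def c_def complex_eq_iff)
    have inr: "norm (of_real r * w) < r" if "norm w < 1" for w :: complex
      using that r by (simp add: norm_mult)
    have ReP: "Re (P w) > 0" if "norm w < 1" for w
      using pos[OF inr[OF that]] e by (simp add: P_def)
    have c: "c > 0" using ReP[of 0] by (simp add: P0)
    have holP: "P holomorphic_on ball 0 1"
    proof -
      have "(p \<circ> (\<lambda>w. of_real r * w)) holomorphic_on ball 0 1"
        by (intro holomorphic_on_compose_gen[OF _ p] holomorphic_intros) (use inr in auto)
      then show ?thesis unfolding P_def by (intro holomorphic_intros) (simp add: o_def)
    qed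
    \<comment> \<open>This maps the right half-plane into the disc and sends \<open>P 0 = c\<close>
      to 0; the imaginary part at 0 was subtracted from \<open>P\<close> for that purpose.\<close>
    define q where "q = (\<lambda>w. (P w - of_real c) / (P w + of_real c))"
    have den: "P w + of_real c \<noteq> 0" if "norm w < 1" for w
      using ReP[OF that] c by (auto simp: complex_eq_iff)
    have "norm (q w) < 1" if "norm w < 1" for w
    proof -
      have "(norm (P w - of_real c))\<^sup>2 < (norm (P w + of_real c))\<^sup>2"
        using mult_pos_pos[OF c ReP[OF that]] unfolding cmod_power2 by (simp add: power2_eq_square algebra_simps)
      then have "norm (P w - of_real c) < norm (P w + of_real c)"
        by (rule power_less_imp_less_base) simp
      then show ?thesis by (simp add: q_def norm_divide divide_simps)
    qed
    moreover have "q holomorphic_on ball 0 1"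
      unfolding q_def by (intro holomorphic_intros holP) (use den in auto)
    moreover have "q 0 = 0" by (simp add: q_def P0)
    ultimately have sch: "norm (q w) \<le> norm w" if "norm w < 1" for w
      using Schwarz_Lemma(1)[of q w] that by auto
    define w where "w = x / of_real r"
    have w: "norm w < 1" "norm w = norm x / r" using x r by (auto simp: w_def norm_divide)
    have "norm (P w - of_real c) \<le> norm w * norm (P w + of_real c)"
      using sch[OF w(1)] den[OF w(1)] by (simp add: q_def norm_divide divide_simps)
    also have "\<dots> \<le> norm w * (norm (P w) + c)"
      using norm_triangle_ineq[of "P w" "of_real c"] c by (intro mult_left_mono) auto
    finally have "norm (P w) - c \<le> norm w * (norm (P w) + c)"
      using norm_triangle_ineq2[of "P w" "of_real c"] c by simp
    then have "norm (P w) * (1 - norm w) \<le> c * (1 + norm w)" by (simp add: algebra_simps)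
    then have "r * (norm (P w) * (1 - norm w)) \<le> r * (c * (1 + norm w))"
      using r by (intro mult_left_mono) auto
    moreover have "r * (norm (P w) * (1 - norm w)) = norm (P w) * (r - norm x)"
      "r * (c * (1 + norm w)) = c * (r + norm x)"
      using r unfolding w(2) by (simp_all add: field_simps)
    ultimately have "norm (P w) * (r - norm x) \<le> c * (r + norm x)" by simp
    then have "norm (P w) \<le> (r + norm x) / (r - norm x) * c"
      using x by (simp add: field_simps)
    moreover have "Re (p x) + e \<le> norm (P w)"
      using complex_Re_le_cmod[of "P w"] r by (simp add: P_def w_def)
    ultimately show ?thesis by (simp add: c_def)
  qed
  define C where "C = (r + norm x) / (r - norm x)"
  have C: "C \<ge> 0" using x r by (simp add: C_def)
  show ?thesis
  proof (rule field_le_epsilon)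
    fix e :: real assume e: "e > 0"
    have "Re (p x) \<le> C * (Re (p 0) + e / (C + 1))"
      using *[of "e / (C + 1)"] e C unfolding C_def[symmetric]
      by (smt (verit) divide_pos_pos)
    also have "\<dots> = C * Re (p 0) + C * e / (C + 1)" by (simp add: algebra_simps)
    also have "C * e / (C + 1) \<le> e" using C e by (simp add: field_simps)
    finally show "Re (p x) \<le> (r + norm x) / (r - norm x) * Re (p 0) + e"
      by (simp add: C_def)
  qed
qed

text \<open>A harmonic polynomial slightly above \<open>S\<close> on the circle dominates
  \<open>S\<close> inside. Harnack compares its values at \<open>x\<close> and at 0, and its value
  at 0 is its mean over the circle.\<close>

lemma touching_subharmonic_circle_bound:
  assumes S: "touching_subharmonic (ball 0 R) S" and r: "r < R"
    and pos: "\<And>z. norm z < R \<Longrightarrow> 0 \<le> S z" and x: "norm x < r"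
  shows "S x \<le> (r + norm x) / (r - norm x) *
      (integral {0..2 * pi} (\<lambda>t. S (of_real r * cis t)) / (2 * pi))"
proof -
  have r0: "r > 0" using x by (meson norm_ge_zero order_le_less_trans)
  define C where "C = (r + norm x) / (r - norm x)"
  have C: "C \<ge> 0" using x r0 by (simp add: C_def)
  have contS: "continuous_on (sphere 0 r) S"
    using S r by (auto simp: touching_subharmonic_def intro: continuous_on_subset)
  have contt: "continuous_on {0..2 * pi} (\<lambda>t. S (of_real r * cis t))"
    by (rule continuous_on_compose2[OF contS]) (use r0 in \<open>auto intro!: continuous_intros simp: norm_mult\<close>)
  define I where "I = integral {0..2 * pi} (\<lambda>t. S (of_real r * cis t))"
  have I: "((\<lambda>t. S (of_real r * cis t)) has_integral I) {0..2 * pi}"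
    unfolding I_def using integrable_continuous_real[OF contt] by (simp add: has_integral_integral)
  have bound: "S x \<le> C * (I / (2 * pi) + 2 * e)" if e: "e > 0" for e
  proof -
    \<comment> \<open>Approximating \<open>S + e\<close> instead of \<open>S\<close> puts the
      polynomial on one side: between \<open>S\<close> and \<open>S + 2 * e\<close>.\<close>
    have "continuous_on (sphere 0 r) (\<lambda>z. S z + e)" by (intro continuous_intros contS)
    then obtain g where g: "real_polynomial_function g"
        "\<And>z. z \<in> sphere 0 r \<Longrightarrow> \<bar>S z + e - g z\<bar> < e"
      using Stone_Weierstrass_real_polynomial_function[OF compact_sphere _ e] by blast
    obtain P where P: "\<And>z. norm z = r \<Longrightarrow> g z = Re (poly P z)"
      using circle_real_polynomial_function[OF g(1), of r] r0 by auto
    have lo: "S z \<le> Re (poly P z)" and hi: "Re (poly P z) \<le> S z + 2 * e" if "norm z = r" for z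
      using g(2)[of z] P[OF that] that by auto
    have hol: "poly P holomorphic_on A" for A
      by (rule holomorphic_on_subset[of _ UNIV]) (auto intro!: holomorphic_intros)
    have mx: "S z \<le> Re (poly P z)" if "norm z \<le> r" for z
      by (rule touching_subharmonic_maximum[OF S hol r0 r lo that])
    have "S x \<le> Re (poly P x)" using mx[of x] x by simp
    also have "\<dots> \<le> C * Re (poly P 0)"
      unfolding C_def
    proof (rule harnack[OF hol _ x])
      fix z :: complex assume "norm z < r"
      with mx[of z] pos[of z] r show "0 \<le> Re (poly P z)" by simp
    qed
    also have "\<dots> \<le> C * (I / (2 * pi) + 2 * e)"
    proof (rule mult_left_mono[OF _ C])
      have "2 * pi * Re (poly P 0) \<le> I + 2 * e * (2 * pi)"
      proof (rule has_integral_le)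
        show "((\<lambda>t. Re (poly P (of_real r * cis t))) has_integral 2 * pi * Re (poly P 0)) {0..2 * pi}"
          by (rule circle_mean_value_Re[OF hol]) (use r0 r in auto)
        show "((\<lambda>t. S (of_real r * cis t) + 2 * e) has_integral (I + 2 * e * (2 * pi))) {0..2 * pi}"
          using has_integral_add[OF I has_integral_const_real[of "2 * e" 0 "2 * pi"]]
          by (simp add: mult_ac)
      qed (use hi r0 in \<open>simp add: norm_mult\<close>)
      then show "Re (poly P 0) \<le> I / (2 * pi) + 2 * e" by (simp add: field_simps)
    qed
    finally show ?thesis .
  qed
  have "S x \<le> C * (I / (2 * pi))"
  proof (rule field_le_epsilon)
    fix e :: real assume e: "e > 0"
    have "S x \<le> C * (I / (2 * pi) + 2 * (e / (2 * (C + 1))))"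
      by (rule bound) (use e C in simp)
    also have "2 * (e / (2 * (C + 1))) = e / (C + 1)" using C by (simp add: field_simps)
    also have "C * (I / (2 * pi) + e / (C + 1)) = C * (I / (2 * pi)) + C * e / (C + 1)"
      by (simp add: algebra_simps)
    also have "C * e / (C + 1) \<le> e" using C e by (simp add: field_simps)
    finally show "S x \<le> C * (I / (2 * pi)) + e" by simp
  qed
  then show ?thesis by (simp add: C_def I_def)
qed

text \<open>The circular means tend to 0 by dominated convergence, while the Harnack factor at the
  fixed point \<open>x\<close> stays bounded as the radii tend to 1.\<close>

lemma touching_subharmonic_radial_zero:
  assumes S: "touching_subharmonic (ball 0 1) S"
    and pos: "\<And>z. norm z < 1 \<Longrightarrow> 0 \<le> S z" and bdd: "\<And>z. norm z < 1 \<Longrightarrow> S z \<le> M"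
    and rad: "AE t in lebesgue_on {0..2 * pi}. ((\<lambda>r. S (of_real r * cis t)) \<longlongrightarrow> 0) (at_left 1)"
    and x: "norm x < 1"
  shows "S x = 0"
proof -
  define r where "r = (\<lambda>n::nat. 1 - (1 - norm x) / (real n + 2))"
  have r: "norm x < r n" "r n < 1" "0 < r n" for n
  proof -
    show "norm x < r n" "r n < 1" using x by (auto simp: r_def field_simps) (smt (verit) mult_nonneg_nonneg norm_ge_zero of_nat_0_le_iff mult_left_le)
    then show "0 < r n" by (meson norm_ge_zero order_le_less_trans)
  qed
  have rlim: "r \<longlonglongrightarrow> 1" unfolding r_def by real_asymp
  have rfil: "filterlim r (at_left 1) sequentially"
    using rlim r(2) by (auto intro!: tendsto_imp_filterlim_at_left always_eventually)
  have contS: "continuous_on (ball 0 1) S"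
    using S by (simp add: touching_subharmonic_def)
  have contt: "continuous_on {0..2 * pi} (\<lambda>t. S (of_real (r n) * cis t))" for n
    by (rule continuous_on_compose2[OF contS])
       (use r[of n] in \<open>auto intro!: continuous_intros simp: norm_mult\<close>)
  have int: "integrable (lebesgue_on {0..2 * pi}) (\<lambda>t. S (of_real (r n) * cis t))" for n
    using continuous_imp_integrable_real[OF contt] .
  have "(\<lambda>n. integral\<^sup>L (lebesgue_on {0..2 * pi}) (\<lambda>t. S (of_real (r n) * cis t)))
      \<longlonglongrightarrow> integral\<^sup>L (lebesgue_on {0..2 * pi}) (\<lambda>t. 0)"
  proof (rule integral_dominated_convergence[where w = "\<lambda>_. M"])
    show "integrable (lebesgue_on {0..2 * pi}) (\<lambda>_. M)"
      by (rule continuous_imp_integrable_real) simp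
    show "AE t in lebesgue_on {0..2 * pi}. (\<lambda>n. S (of_real (r n) * cis t)) \<longlonglongrightarrow> 0"
      using rad by eventually_elim (rule filterlim_compose[OF _ rfil])
    show "AE t in lebesgue_on {0..2 * pi}. norm (S (of_real (r n) * cis t)) \<le> M" for n
    proof (rule AE_I2)
      fix t
      have "norm (of_real (r n) * cis t) < 1" using r[of n] by (simp add: norm_mult)
      from pos[OF this] bdd[OF this] show "norm (S (of_real (r n) * cis t)) \<le> M" by simp
    qed
  qed (use int in auto)
  then have lim: "(\<lambda>n. integral {0..2 * pi} (\<lambda>t. S (of_real (r n) * cis t))) \<longlonglongrightarrow> 0"
    by (simp add: lebesgue_integral_eq_integral[OF int])
  have "(\<lambda>n. (r n + norm x) / (r n - norm x) *
      (integral {0..2 * pi} (\<lambda>t. S (of_real (r n) * cis t)) / (2 * pi)))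
      \<longlonglongrightarrow> (1 + norm x) / (1 - norm x) * (0 / (2 * pi))"
    by (intro tendsto_intros rlim lim) (use x in auto)
  then have "S x \<le> (1 + norm x) / (1 - norm x) * (0 / (2 * pi))"
    by (rule LIMSEQ_le_const)
       (use touching_subharmonic_circle_bound[OF S r(2) pos r(1)] in auto)
  with pos[OF x] show ?thesis by simp
qed

section \<open>Lower bounds for Carleson--Newman Blaschke products\<close>

text \<open>The pseudohyperbolic distance, which is the modulus at \<open>z\<close> of the Blaschke
  factor with zero \<open>a\<close>.\<close>

definition pseudo_dist :: "complex \<Rightarrow> complex \<Rightarrow> real" where
  "pseudo_dist a z = norm (z - a) / norm (1 - cnj a * z)"

lemma one_minus_cnj_mult_nz:
  assumes "norm a < 1" "norm z \<le> 1"
  shows "1 - cnj a * z \<noteq> 0"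
proof
  assume "1 - cnj a * z = 0"
  then have "norm (cnj a * z) = 1" by (metis eq_iff_diff_eq_0 norm_one)
  then have "norm a * norm z = 1" by (simp add: norm_mult)
  with assms show False
    by (metis mult_left_le norm_ge_zero not_less)
qed

lemma one_minus_pseudo_dist_sq:
  assumes "norm a < 1" "norm z < 1"
  shows "1 - (pseudo_dist a z)\<^sup>2 =
    (1 - (norm z)\<^sup>2) * (1 - (norm a)\<^sup>2) / (norm (1 - cnj a * z))\<^sup>2"
proof -
  have nz: "norm (1 - cnj a * z) \<noteq> 0" using one_minus_cnj_mult_nz[of a z] assms by simp
  have "(norm (1 - cnj a * z))\<^sup>2 - (norm (z - a))\<^sup>2 = (1 - (norm z)\<^sup>2) * (1 - (norm a)\<^sup>2)"
    unfolding cmod_power2 by (simp add: power2_eq_square algebra_simps)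
  then show ?thesis
    using nz unfolding pseudo_dist_def by (simp add: power_divide field_simps)
qed

lemma pseudo_dist_le_1:
  assumes "norm a < 1" "norm z < 1"
  shows "pseudo_dist a z \<le> 1"
proof -
  have "0 \<le> 1 - (pseudo_dist a z)\<^sup>2"
    unfolding one_minus_pseudo_dist_sq[OF assms]
    using assms by (intro divide_nonneg_nonneg mult_nonneg_nonneg) (auto simp: power_le_one)
  then show ?thesis by (simp add: abs_square_le_1 pseudo_dist_def)
qed

lemma pseudo_dist_nonneg [simp]: "0 \<le> pseudo_dist a z"
  by (simp add: pseudo_dist_def)

lemma norm_blaschke_factor:
  "norm (blaschke_factor a z) = pseudo_dist a z"
  by (simp add: blaschke_factor_def pseudo_dist_def norm_mult norm_divide norm_minus_commute)

lemma blaschke_factor_eq_0_iff: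
  assumes "norm a < 1" "norm z < 1"
  shows "blaschke_factor a z = 0 \<longleftrightarrow> z = a"
proof -
  have "blaschke_factor a z = 0 \<longleftrightarrow> pseudo_dist a z = 0"
    by (simp flip: norm_blaschke_factor)
  also have "\<dots> \<longleftrightarrow> z = a"
    using assms one_minus_cnj_mult_nz[of a z] by (simp add: pseudo_dist_def)
  finally show ?thesis .
qed

text \<open>The numerator of the difference contains \<open>1 - norm a\<close> as a factor, so the
  Blaschke condition yields absolute convergence of the product at every \<open>z\<close>.\<close>

lemma norm_blaschke_factor_minus_1:
  assumes a: "norm a < 1" and z: "norm z < 1"
  shows "norm (blaschke_factor a z - 1) \<le> 2 / (1 - norm z) * (1 - norm a)"
proof (cases "a = 0")
  case True
  have "norm (z - 1) \<le> norm z + 1" using norm_triangle_ineq4[of z 1] by simp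
  also have "\<dots> \<le> 2 / (1 - norm z)"
  proof -
    have "(norm z + 1) * (1 - norm z) \<le> 2"
      using z by (simp add: algebra_simps flip: power2_eq_square)
    then show ?thesis using z by (simp add: field_simps)
  qed
  finally show ?thesis by (simp add: True blaschke_factor_def)
next
  case False
  have nz: "1 - cnj a * z \<noteq> 0" using one_minus_cnj_mult_nz[of a z] assms by simp
  have aa: "cnj a * a = of_real (norm a) * of_real (norm a)"
    using complex_norm_square[of a] by (simp add: power2_eq_square mult.commute)
  have num: "of_real (norm a) * (a - z) - a * (1 - cnj a * z) =
      - (of_real (1 - norm a) * (a + of_real (norm a) * z))"
  proof -
    have "of_real (norm a) * (a - z) - a * (1 - cnj a * z) =
      of_real (norm a) * (a - z) - a + cnj a * a * z" by (simp add: algebra_simps)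
    then show ?thesis unfolding aa by (simp add: algebra_simps)
  qed
  have "blaschke_factor a z - 1 =
      (of_real (norm a) * (a - z) - a * (1 - cnj a * z)) / (a * (1 - cnj a * z))"
    using False nz by (simp add: blaschke_factor_def field_simps)
  also have "norm \<dots> = (1 - norm a) * norm (a + of_real (norm a) * z) / (norm a * norm (1 - cnj a * z))"
    unfolding num norm_divide norm_minus_cancel norm_mult norm_of_real using a by simp
  also have "\<dots> \<le> (1 - norm a) * (2 * norm a) / (norm a * (1 - norm z))"
  proof (intro frac_le mult_left_mono mult_nonneg_nonneg)
    have "norm (a + of_real (norm a) * z) \<le> norm a + norm a * norm z"
      using norm_triangle_ineq[of a "of_real (norm a) * z"] by (simp add: norm_mult)
    also have "\<dots> \<le> norm a + norm a * 1" using z by (intro add_left_mono mult_left_mono) auto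
    finally show "norm (a + of_real (norm a) * z) \<le> 2 * norm a" by simp
    have "norm (cnj a * z) \<le> 1 * norm z" unfolding norm_mult using a by (intro mult_right_mono) auto
    then show "1 - norm z \<le> norm (1 - cnj a * z)"
      using norm_triangle_ineq2[of 1 "cnj a * z"] by simp
  qed (use a z False in auto)
  also have "\<dots> = 2 / (1 - norm z) * (1 - norm a)" using False z by (simp add: field_simps)
  finally show ?thesis .
qed

text \<open>A common format for both kinds of product: \<open>I\<close> is \<open>{..<n}\<close> in
  the finite case and \<open>UNIV\<close> in the infinite one, and \<open>a\<close> is unconstrained
  outside \<open>I\<close>.\<close>

lemma blaschke_product_partial_products:
  assumes "blaschke_product b"
  obtains I :: "nat set" and a :: "nat \<Rightarrow> complex" where
    "\<And>k. norm (a k) < 1 \<or> k \<notin> I"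
    "\<And>z. norm z < 1 \<Longrightarrow> (\<lambda>m. \<Prod>k\<in>I \<inter> {..<m}. pseudo_dist (a k) z) \<longlonglongrightarrow> norm (b z)"
    "\<And>z. norm z < 1 \<Longrightarrow> b z = 0 \<Longrightarrow> z \<in> a ` I"
  using assms unfolding blaschke_product_def
proof
  assume "finite_blaschke_product b"
  then obtain c and n :: nat and a where *: "norm c = 1" "\<And>k. k < n \<Longrightarrow> norm (a k) < 1"
    "\<And>z. norm z < 1 \<Longrightarrow> b z = c * (\<Prod>k<n. blaschke_factor (a k) z)"
    unfolding finite_blaschke_product_def by (auto simp: Ball_def)
  show thesis
  proof (rule that[of a "{..<n}"])
    fix z :: complex assume z: "norm z < 1"
    have "(\<Prod>k\<in>{..<n} \<inter> {..<m}. pseudo_dist (a k) z) = norm (b z)" if "m \<ge> n" for m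
    proof -
      have "{..<n} \<inter> {..<m} = {..<n}" using that by auto
      then show ?thesis
        using * z by (simp add: norm_mult prod_norm[symmetric] norm_blaschke_factor)
    qed
    then show "(\<lambda>m. \<Prod>k\<in>{..<n} \<inter> {..<m}. pseudo_dist (a k) z) \<longlonglongrightarrow> norm (b z)"
      by (intro tendsto_eventually eventually_sequentiallyI[of n])
    assume "b z = 0"
    then show "z \<in> a ` {..<n}" using * z by (auto simp: blaschke_factor_eq_0_iff)
  qed (use * in auto)
next
  assume "infinite_blaschke_product b"
  then obtain c a where *: "norm c = 1" "\<And>k. norm (a k) < 1" "summable (\<lambda>k. 1 - norm (a k))"
    "\<And>z. norm z < 1 \<Longrightarrow> b z = c * (\<Prod>k. blaschke_factor (a k) z)"
    unfolding infinite_blaschke_product_def by (auto simp: Ball_def)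
  have conv: "convergent_prod (\<lambda>k. blaschke_factor (a k) z)" if z: "norm z < 1" for z
  proof (rule abs_convergent_prod_imp_convergent_prod, rule summable_imp_abs_convergent_prod)
    show "summable (\<lambda>k. norm (blaschke_factor (a k) z - 1))"
      by (rule summable_comparison_test'[OF summable_mult[OF *(3), of "2 / (1 - norm z)"], of 0])
         (use norm_blaschke_factor_minus_1[OF *(2) z] in simp)
  qed
  show thesis
  proof (rule that[of a UNIV])
    fix z :: complex assume z: "norm z < 1"
    have "(\<lambda>m. \<Prod>k<m. blaschke_factor (a k) z) \<longlonglongrightarrow> (\<Prod>k. blaschke_factor (a k) z)"
      using convergent_prod_has_prod[OF conv[OF z]] by (rule has_prod_imp_tendsto')
    then have "(\<lambda>m. norm (c * (\<Prod>k<m. blaschke_factor (a k) z))) \<longlonglongrightarrow> norm (b z)"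
      unfolding *(4)[OF z] by (intro tendsto_intros)
    then show "(\<lambda>m. \<Prod>k\<in>UNIV \<inter> {..<m}. pseudo_dist (a k) z) \<longlonglongrightarrow> norm (b z)"
      by (simp add: norm_mult *(1) prod_norm[symmetric] norm_blaschke_factor)
    assume "b z = 0"
    then have "(\<Prod>k. blaschke_factor (a k) z) = 0" using * z by auto
    then obtain k where "blaschke_factor (a k) z = 0"
      using prodinf_nonzero[OF conv[OF z]] by blast
    then show "z \<in> range a" using * z by (auto simp: blaschke_factor_eq_0_iff)
  qed (use * in auto)
qed

section \<open>Multiplicities of zeros and test functions for the Carleson condition\<close>

lemma zorder_ge_pseudo_dist_power:
  assumes hol: "f holomorphic_on ball 0 1" and nz: "\<exists>w\<in>ball 0 1. f w \<noteq> 0" and a: "norm a < 1"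
    and le: "\<And>z. norm z < 1 \<Longrightarrow> norm (f z) \<le> pseudo_dist a z ^ n"
  shows "int n \<le> zorder f a"
proof (rule ccontr)
  assume neg: "\<not> int n \<le> zorder f a"
  define m where "m = nat (zorder f a)"
  define g where "g = zor_poly f a"
  have "(if f a = 0 then zorder f a > 0 else zorder f a = 0) \<and>
      (\<exists>r. r > 0 \<and> cball a r \<subseteq> ball 0 1 \<and> g holomorphic_on cball a r \<and>
        (\<forall>w\<in>cball a r. f w = g w * (w - a) ^ m \<and> g w \<noteq> 0))"
    unfolding g_def m_def by (rule zorder_exist_zero[OF hol _ _ _ nz]) (use a in auto)
  then obtain r where r: "r > 0" "cball a r \<subseteq> ball 0 1" "g holomorphic_on cball a r"
    "\<And>w. w \<in> cball a r \<Longrightarrow> f w = g w * (w - a) ^ m" "\<And>w. w \<in> cball a r \<Longrightarrow> g w \<noteq> 0"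
    and "zorder f a \<ge> 0"
    by (metis less_imp_le order_refl)
  then have mn: "m < n" using neg by (simp add: m_def)
  \<comment> \<open>If the order \<open>m\<close> were below \<open>n\<close>, the cofactor
    \<open>g\<close> would be bounded by a positive power of \<open>norm (w - a)\<close> times a
    bounded term, hence would vanish at \<open>a\<close>.\<close>
  have bound: "norm (g w) \<le> norm (w - a) ^ (n - m) / norm (1 - cnj a * w) ^ n"
    if w: "w \<in> ball a r - {a}" for w
  proof -
    have "w \<in> cball a r" using w by auto
    have wd: "norm w < 1" using r(2) \<open>w \<in> cball a r\<close> by auto
    have pos: "norm (w - a) > 0" using w by auto
    have "norm (g w) * norm (w - a) ^ m \<le> norm (w - a) ^ n / norm (1 - cnj a * w) ^ n"
      using le[OF wd] r(4)[OF \<open>w \<in> cball a r\<close>]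
      by (simp add: norm_mult norm_power pseudo_dist_def power_divide)
    also have "norm (w - a) ^ n = norm (w - a) ^ (n - m) * norm (w - a) ^ m"
      using mn by (simp flip: power_add)
    finally have "norm (g w) * norm (w - a) ^ m \<le>
      (norm (w - a) ^ (n - m) / norm (1 - cnj a * w) ^ n) * norm (w - a) ^ m" by simp
    then show ?thesis using pos by (meson mult_le_cancel_right_pos zero_less_power)
  qed
  have "continuous_on (ball a r) g"
    using r(3) by (meson ball_subset_cball continuous_on_subset holomorphic_on_imp_continuous_on)
  then have lim: "(\<lambda>w. norm (g w)) \<midarrow>a\<rightarrow> norm (g a)"
    using r(1) by (metis continuous_on_eq_continuous_at centre_in_ball continuous_at open_ball tendsto_norm)
  have "((\<lambda>w. norm (w - a) ^ (n - m) / norm (1 - cnj a * w) ^ n) \<longlongrightarrow>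
      norm (a - a) ^ (n - m) / norm (1 - cnj a * a) ^ n) (at a)"
    by (intro tendsto_intros) (use one_minus_cnj_mult_nz[of a a] a in auto)
  then have lim0: "((\<lambda>w. norm (w - a) ^ (n - m) / norm (1 - cnj a * w) ^ n) \<longlongrightarrow> 0) (at a)"
    using mn by (simp add: power_0_left)
  have "\<forall>\<^sub>F w in at a. w \<in> ball a r - {a}"
    by (rule eventually_mono[OF eventually_at_ball'[OF r(1)]]) auto
  then have "\<forall>\<^sub>F w in at a. norm (g w) \<le> norm (w - a) ^ (n - m) / norm (1 - cnj a * w) ^ n"
    by eventually_elim (rule bound)
  then have "norm (g a) \<le> 0"
    by (rule tendsto_le[OF _ lim0 lim, rotated]) simp
  with r(5)[of a] r(1) show False by simp
qed

text \<open>The normalised square of the Szego kernel: on the unit circle its modulus is the Poisson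
  kernel of \<open>c\<close>, so its Hardy norm is bounded uniformly in \<open>c\<close>.\<close>

definition carleson_kernel :: "complex \<Rightarrow> complex \<Rightarrow> complex" where
  "carleson_kernel c w = of_real (1 - (norm c)\<^sup>2) / (1 - cnj c * w)\<^sup>2"

lemma carleson_kernel_holomorphic:
  assumes "norm c < 1"
  shows "carleson_kernel c holomorphic_on ball 0 1"
  unfolding carleson_kernel_def
  by (intro holomorphic_intros) (use one_minus_cnj_mult_nz[of c] assms in auto)

lemma hardy_mean_carleson_kernel:
  assumes c: "norm c < 1" and r: "0 \<le> r" "r < 1"
  shows "hardy_mean (carleson_kernel c) r \<le> 1"
proof -
  \<comment> \<open>\<open>Re g\<close> is the Poisson kernel, which dominates the modulus of the Carleson kernel.\<close>
  define g where "g = (\<lambda>w. (1 + cnj c * w) / (1 - cnj c * w))"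
  have hol: "g holomorphic_on ball 0 1"
    unfolding g_def by (intro holomorphic_intros) (use one_minus_cnj_mult_nz[of c] c in auto)
  have le: "norm (carleson_kernel c (of_real r * cis t)) \<le> Re (g (of_real r * cis t))" for t
  proof -
    define w where "w = of_real r * cis t"
    have w: "norm w = r" using r by (simp add: w_def norm_mult)
    have nz: "1 - cnj c * w \<noteq> 0" using one_minus_cnj_mult_nz[of c w] c r w by simp
    have "norm (carleson_kernel c w) = (1 - (norm c)\<^sup>2) / (norm (1 - cnj c * w))\<^sup>2"
      unfolding carleson_kernel_def norm_divide norm_power norm_of_real
      using c by (simp add: power_le_one)
    also have "\<dots> \<le> (1 - (norm (cnj c * w))\<^sup>2) / (norm (1 - cnj c * w))\<^sup>2"
      unfolding norm_mult w complex_mod_cnj power_mult_distrib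
      using r by (intro divide_right_mono diff_left_mono mult_left_le) (auto simp: power_le_one)
    also have "\<dots> = Re (g w)"
      using nz unfolding g_def Re_divide cmod_power2
      by (simp add: power2_eq_square algebra_simps)
    finally show ?thesis unfolding w_def .
  qed
  have cont: "continuous_on {0..2 * pi} (\<lambda>t. norm (carleson_kernel c (of_real r * cis t)))"
    by (intro continuous_on_norm continuous_on_compose2[OF
          holomorphic_on_imp_continuous_on[OF carleson_kernel_holomorphic[OF c]]] continuous_intros)
       (use r in \<open>auto simp: norm_mult\<close>)
  have "integral {0..2 * pi} (\<lambda>t. norm (carleson_kernel c (of_real r * cis t))) \<le> 2 * pi * Re (g 0)"
    by (rule has_integral_le[OF integrable_integral[OF integrable_continuous_real[OF cont]]
          circle_mean_value_Re[OF hol r]]) (rule le)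
  then show ?thesis by (simp add: hardy_mean_def g_def)
qed

lemma carleson_measure_kernel:
  assumes "carleson_measure M"
  obtains C where "C > 0" "\<And>c. norm c < 1 \<Longrightarrow>
    (\<integral>\<^sup>+ z. ennreal (norm (carleson_kernel c z)) \<partial>M) \<le> ennreal C"
proof -
  obtain C where C: "C > 0"
    "\<And>f. f \<in> hardy1 \<Longrightarrow> (\<integral>\<^sup>+ z. ennreal (norm (f z)) \<partial>M) \<le> ennreal (C * hardy1_norm f)"
    using assms unfolding carleson_measure_def by blast
  show thesis
  proof (rule that[OF C(1)])
    fix c :: complex assume c: "norm c < 1"
    have "carleson_kernel c \<in> hardy1"
      using carleson_kernel_holomorphic[OF c] hardy_mean_carleson_kernel[OF c]
      by (auto simp: hardy1_def intro!: bdd_aboveI[of _ 1])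
    from C(2)[OF this] have "(\<integral>\<^sup>+ z. ennreal (norm (carleson_kernel c z)) \<partial>M)
      \<le> ennreal (C * hardy1_norm (carleson_kernel c))" .
    also have "hardy1_norm (carleson_kernel c) \<le> 1"
      unfolding hardy1_norm_def
      by (rule cSUP_least) (use hardy_mean_carleson_kernel[OF c] in auto)
    then have "ennreal (C * hardy1_norm (carleson_kernel c)) \<le> ennreal (C * 1)"
      using C(1) by (intro ennreal_leI mult_left_mono) auto
    finally show "(\<integral>\<^sup>+ z. ennreal (norm (carleson_kernel c z)) \<partial>M) \<le> ennreal C" by simp
  qed
qed

text \<open>Keeping only the atoms in \<open>F\<close>, with masses bounded below through
  \<open>zorder\<close>, is enough for testing the Carleson condition.\<close>

lemma nn_integral_zero_measure_ge:
  assumes g: "continuous_on unit_disc g" and F: "finite F" "F \<subseteq> {z \<in> unit_disc. b z = 0}"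
    and g0: "\<And>z. z \<in> F \<Longrightarrow> 0 \<le> g z"
    and zo: "\<And>z. z \<in> F \<Longrightarrow> real (n z) \<le> zorder b z"
  shows "ennreal (\<Sum>z\<in>F. real (n z) * (1 - norm z) * g z) \<le> (\<integral>\<^sup>+ z. ennreal (g z) \<partial>zero_measure b)"
proof -
  define Z where "Z = {z \<in> unit_disc. b z = 0}"
  have F1: "0 \<le> 1 - norm z" if "z \<in> F" for z using F that by auto
  have meas: "(\<lambda>z. ennreal (g z)) \<in> borel_measurable (restrict_space borel unit_disc)"
    using borel_measurable_continuous_on_restrict[OF g] by measurable
  have "ennreal (\<Sum>z\<in>F. real (n z) * (1 - norm z) * g z) =
      (\<Sum>z\<in>F. ennreal (real (n z) * (1 - norm z) * g z))"
    by (rule sum_ennreal[symmetric]) (use F1 g0 in auto)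
  also have "\<dots> \<le> (\<Sum>z\<in>F. ennreal (zorder b z * (1 - norm z)) * ennreal (g z))"
  proof (rule sum_mono)
    fix z assume z: "z \<in> F"
    have "ennreal (real (n z) * (1 - norm z) * g z) \<le> ennreal (zorder b z * (1 - norm z) * g z)"
      using z F1 g0 zo by (intro ennreal_leI mult_right_mono) auto
    also have "\<dots> = ennreal (zorder b z * (1 - norm z)) * ennreal (g z)"
      by (rule ennreal_mult) (use z F1 g0 zo in \<open>auto intro!: mult_nonneg_nonneg intro: order_trans[OF of_nat_0_le_iff]\<close>)
    finally show "ennreal (real (n z) * (1 - norm z) * g z) \<le> \<dots>" .
  qed
  also have "\<dots> = (\<integral>\<^sup>+ z. ennreal (zorder b z * (1 - norm z)) * ennreal (g z) * indicator F z \<partial>count_space Z)"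
    by (subst nn_integral_count_space'[of F]) (use F in \<open>auto simp: Z_def\<close>)
  also have "\<dots> \<le> (\<integral>\<^sup>+ z. ennreal (zorder b z * (1 - norm z)) * ennreal (g z) \<partial>count_space Z)"
    by (intro nn_integral_mono) (auto simp: indicator_def)
  also have "\<dots> = (\<integral>\<^sup>+ z. ennreal (g z) \<partial>density (count_space Z) (\<lambda>z. ennreal (zorder b z * (1 - norm z))))"
    by (rule nn_integral_density[symmetric]) auto
  also have "\<dots> = (\<integral>\<^sup>+ z. ennreal (g z) \<partial>zero_measure b)"
    unfolding zero_measure_def Z_def
    by (rule nn_integral_distr[symmetric]) (use meas in \<open>auto simp: space_restrict_space\<close>)
  finally show ?thesis .
qed

lemma one_minus_pseudo_dist_sq_le_kernel:
  assumes "norm c < 1" "norm a < 1"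
  shows "1 - (pseudo_dist a c)\<^sup>2 \<le> 2 * ((1 - norm a) * norm (carleson_kernel c a))"
proof -
  have n: "norm (1 - cnj a * c) = norm (1 - cnj c * a)"
    by (metis complex_cnj_cnj complex_cnj_diff complex_cnj_mult complex_cnj_one complex_mod_cnj mult.commute)
  have "1 - (pseudo_dist a c)\<^sup>2 = (1 - (norm a)\<^sup>2) * ((1 - (norm c)\<^sup>2) / (norm (1 - cnj c * a))\<^sup>2)"
    using one_minus_pseudo_dist_sq[OF assms(2,1)] n by simp
  also have "\<dots> \<le> (2 * (1 - norm a)) * ((1 - (norm c)\<^sup>2) / (norm (1 - cnj c * a))\<^sup>2)"
  proof (rule mult_right_mono)
    show "1 - (norm a)\<^sup>2 \<le> 2 * (1 - norm a)"
      using zero_le_power2[of "1 - norm a"] by (simp add: power2_diff)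
  qed (use assms in \<open>simp add: power_le_one\<close>)
  also have "(1 - (norm c)\<^sup>2) / (norm (1 - cnj c * a))\<^sup>2 = norm (carleson_kernel c a)"
    unfolding carleson_kernel_def norm_divide norm_power norm_of_real
    using assms by (simp add: power_le_one)
  finally show ?thesis by (simp only: mult.assoc)
qed

text \<open>Testing the Carleson condition on the kernel at \<open>c\<close> bounds the sum of
  \<open>(1 - norm a) * norm (carleson_kernel c a)\<close> over the zeros, and twice each term
  dominates \<open>1 - (pseudo_dist a c)\<^sup>2\<close>. The bound does not depend on
  \<open>c\<close>.\<close>

lemma carleson_newman_sum_bound:
  assumes hol: "b holomorphic_on ball 0 1" and nz: "\<exists>w\<in>ball 0 1. b w \<noteq> 0"
    and car: "carleson_measure (zero_measure b)"
    and a: "\<And>k. norm (a k) < 1 \<or> k \<notin> I"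
    and lim: "\<And>z. norm z < 1 \<Longrightarrow>
      (\<lambda>m. \<Prod>k\<in>I \<inter> {..<m}. pseudo_dist (a k) z) \<longlonglongrightarrow> norm (b z)"
  obtains K where "K > 0" "\<And>c F. norm c < 1 \<Longrightarrow> finite F \<Longrightarrow> F \<subseteq> I \<Longrightarrow>
    (\<Sum>k\<in>F. 1 - (pseudo_dist (a k) c)\<^sup>2) \<le> K"
proof -
  obtain C where C: "C > 0" "\<And>c. norm c < 1 \<Longrightarrow>
    (\<integral>\<^sup>+ z. ennreal (norm (carleson_kernel c z)) \<partial>zero_measure b) \<le> ennreal C"
    using carleson_measure_kernel[OF car] by blast
  show thesis
  proof (rule that[of "2 * C"])
    fix c :: complex and F :: "nat set"
    assume c: "norm c < 1" and F: "finite F" "F \<subseteq> I"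
    have aF: "norm (a k) < 1" if "k \<in> F" for k using a[of k] F that by auto
    define n where "n = (\<lambda>z. card {k \<in> F. a k = z})"
    \<comment> \<open>In a partial product that contains all of \<open>F\<close>, the indices of
      \<open>F\<close> with \<open>a k = z\<close> produce the power, and all other factors are at
      most 1.\<close>
    have le: "norm (b w) \<le> pseudo_dist z w ^ n z" if w: "norm w < 1" for z w
    proof (rule LIMSEQ_le_const2[OF lim[OF w]], intro exI allI impI)
      \<comment> \<open>\<open>insert 0\<close> keeps \<open>Max\<close> meaningful when
        \<open>F\<close> is empty.\<close>
      fix m assume m: "Suc (Max (insert 0 F)) \<le> m"
      have sub: "{k \<in> F. a k = z} \<subseteq> I \<inter> {..<m}"
      proof
        fix k assume "k \<in> {k \<in> F. a k = z}"
        then have "k \<in> F" by simp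
        then have "k \<le> Max (insert 0 F)" using F by (intro Max_ge) auto
        then have "k < m" using m by linarith
        then show "k \<in> I \<inter> {..<m}" using F \<open>k \<in> F\<close> by auto
      qed
      have "(\<Prod>k\<in>I \<inter> {..<m}. pseudo_dist (a k) w) \<le> (\<Prod>k\<in>{k \<in> F. a k = z}. pseudo_dist (a k) w)"
      proof -
        have "(\<Prod>k\<in>I \<inter> {..<m} - {k \<in> F. a k = z}. pseudo_dist (a k) w) \<le> 1"
          by (rule prod_le_1) (use a w in \<open>auto intro!: pseudo_dist_le_1\<close>)
        then show ?thesis
          by (subst prod.subset_diff[OF sub]) (auto intro!: mult_left_le_one_le prod_nonneg simp del: prod_constant)
      qed
      also have "\<dots> = pseudo_dist z w ^ n z"
        by (simp add: n_def)
      finally show "(\<Prod>k\<in>I \<inter> {..<m}. pseudo_dist (a k) w) \<le> pseudo_dist z w ^ n z" .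
    qed
    have zo: "real (n z) \<le> zorder b z" if "z \<in> a ` F" for z
    proof -
      have "int (n z) \<le> zorder b z"
        by (rule zorder_ge_pseudo_dist_power[OF hol nz _ le]) (use that aF in auto)
      then show ?thesis by (metis of_int_le_iff of_int_of_nat_eq)
    qed
    have zero: "b z = 0" if z: "z \<in> a ` F" for z
    proof -
      have "n z > 0" using z F by (auto simp: n_def card_gt_0_iff)
      then show ?thesis using le[of z z] z aF by (auto simp: pseudo_dist_def power_0_left)
    qed
    define g where "g = (\<lambda>z. norm (carleson_kernel c z))"
    have "(\<Sum>k\<in>F. 1 - (pseudo_dist (a k) c)\<^sup>2) \<le> (\<Sum>k\<in>F. 2 * ((1 - norm (a k)) * g (a k)))"
      unfolding g_def by (intro sum_mono one_minus_pseudo_dist_sq_le_kernel c aF)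
    also have "\<dots> = 2 * (\<Sum>k\<in>F. (1 - norm (a k)) * g (a k))"
      by (simp add: sum_distrib_left)
    \<comment> \<open>Repeated zeros are collected by value, because the measure has one atom per
      point with the multiplicity in its mass.\<close>
    also have "(\<Sum>k\<in>F. (1 - norm (a k)) * g (a k)) =
        (\<Sum>z\<in>a ` F. \<Sum>k\<in>{k \<in> F. a k = z}. (1 - norm (a k)) * g (a k))"
      by (rule sum.image_gen[OF F(1)])
    also have "\<dots> = (\<Sum>z\<in>a ` F. real (n z) * (1 - norm z) * g z)"
      by (intro sum.cong refl) (simp add: n_def mult.assoc)
    also have "\<dots> \<le> C"
    proof -
      have "ennreal (\<Sum>z\<in>a ` F. real (n z) * (1 - norm z) * g z) \<le>
          (\<integral>\<^sup>+ z. ennreal (g z) \<partial>zero_measure b)"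
      proof (rule nn_integral_zero_measure_ge)
        show "continuous_on unit_disc g"
          unfolding g_def
          by (intro continuous_on_norm holomorphic_on_imp_continuous_on carleson_kernel_holomorphic c)
      qed (use F zo zero aF in \<open>auto simp: g_def\<close>)
      also have "\<dots> \<le> ennreal C" unfolding g_def by (rule C(2)[OF c])
      finally show ?thesis using C(1) by (simp add: ennreal_le_iff)
    qed
    finally show "(\<Sum>k\<in>F. 1 - (pseudo_dist (a k) c)\<^sup>2) \<le> 2 * C" by simp
  qed (use C in simp)
qed

text \<open>Apply \<open>ln t \<le> t - 1\<close> at \<open>t = 1 / (x k)\<^sup>2\<close>. This
  gives a lower bound for \<open>2 * ln (x k)\<close>, and hence for \<open>ln (x k)\<close>, which
  is nonpositive and so at least its double.\<close>

lemma prod_ge_exp_sum: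
  fixes x :: "'a \<Rightarrow> real"
  assumes "finite F" and "0 < e" and "\<And>k. k \<in> F \<Longrightarrow> e \<le> x k" "\<And>k. k \<in> F \<Longrightarrow> x k \<le> 1"
  shows "exp (- (\<Sum>k\<in>F. 1 - (x k)\<^sup>2) / e\<^sup>2) \<le> (\<Prod>k\<in>F. x k)"
proof -
  have "exp (- (1 - (x k)\<^sup>2) / e\<^sup>2) \<le> x k" if k: "k \<in> F" for k
  proof -
    have x: "e \<le> x k" "x k \<le> 1" using assms k by auto
    then have "0 < x k" using assms(2) by linarith
    note x = x this
    have "e\<^sup>2 \<le> (x k)\<^sup>2" using x assms(2) by (intro power_mono) auto
    then have "(1 - (x k)\<^sup>2) / (x k)\<^sup>2 \<le> (1 - (x k)\<^sup>2) / e\<^sup>2"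
      using x assms(2) by (intro divide_left_mono) (auto simp: power_le_one)
    moreover have "(1 - (x k)\<^sup>2) / (x k)\<^sup>2 = 1 / (x k)\<^sup>2 - 1"
      using x by (simp add: field_simps)
    moreover have "ln (1 / (x k)\<^sup>2) \<le> 1 / (x k)\<^sup>2 - 1"
      by (rule ln_le_minus_one) (use x in auto)
    moreover have "ln (1 / (x k)\<^sup>2) = - 2 * ln (x k)"
      using x by (simp add: ln_div ln_realpow)
    moreover have "ln (x k) \<le> 0" using x by simp
    moreover have "- (1 - (x k)\<^sup>2) / e\<^sup>2 = - ((1 - (x k)\<^sup>2) / e\<^sup>2)"
      by (rule minus_divide_left[symmetric])
    ultimately have "- (1 - (x k)\<^sup>2) / e\<^sup>2 \<le> ln (x k)" by linarith
    then show ?thesis using x(3) by (metis exp_le_cancel_iff exp_ln)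
  qed
  then have "(\<Prod>k\<in>F. exp (- (1 - (x k)\<^sup>2) / e\<^sup>2)) \<le> (\<Prod>k\<in>F. x k)"
    by (intro prod_mono) auto
  also have "(\<Prod>k\<in>F. exp (- (1 - (x k)\<^sup>2) / e\<^sup>2)) = exp (\<Sum>k\<in>F. - (1 - (x k)\<^sup>2) / e\<^sup>2)"
    using assms(1) by (simp add: exp_sum)
  also have "(\<Sum>k\<in>F. - (1 - (x k)\<^sup>2) / e\<^sup>2) = - (\<Sum>k\<in>F. 1 - (x k)\<^sup>2) / e\<^sup>2"
    by (simp only: sum_divide_distrib[symmetric] sum_negf)
  finally show ?thesis .
qed

section \<open>Pseudohyperbolic estimates on Whitney discs\<close>

lemma pseudo_dist_whitney_lower:
  assumes c: "norm c < 1" and a: "norm a < 1" and zc: "norm (z - c) \<le> (1 - norm c) / 4"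
    and th: "0 < \<theta>" "\<theta> \<le> 1" and za: "\<theta> * (1 - norm c) \<le> norm (z - a)"
  shows "\<theta> / 4 \<le> pseudo_dist a z"
proof -
  have nz: "norm z \<le> norm c + norm (z - c)"
    by (metis add.commute diff_add_cancel norm_triangle_ineq)
  have z1: "norm z < 1" using nz zc c by simp
  \<comment> \<open>This splits the denominator into a part comparable to \<open>1 - norm c\<close>
    and one of size at most \<open>norm (z - a)\<close>; by \<open>za\<close> both are controlled by
    \<open>norm (z - a) / \<theta>\<close>.\<close>
  have eq: "1 - cnj a * z = of_real (1 - (norm z)\<^sup>2) + z * cnj (z - a)"
    by (simp add: algebra_simps complex_norm_square del: of_real_power)
  have "norm (1 - cnj a * z) \<le> \<bar>1 - (norm z)\<^sup>2\<bar> + norm z * norm (z - a)"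
    unfolding eq by (rule order_trans[OF norm_triangle_ineq]) (simp only: norm_of_real norm_mult complex_mod_cnj order_refl)
  also have "\<bar>1 - (norm z)\<^sup>2\<bar> = 1 - (norm z)\<^sup>2" using z1 by (simp add: power_le_one)
  also have "1 - (norm z)\<^sup>2 \<le> 2 * (1 - norm z)"
    using zero_le_power2[of "1 - norm z"] by (simp add: power2_diff)
  also have "norm c \<le> norm z + norm (z - c)"
    by (metis add.commute diff_add_cancel norm_minus_commute norm_triangle_ineq)
  then have "2 * (1 - norm z) \<le> 5/2 * (1 - norm c)" using zc by simp
  also have "1 - norm c \<le> norm (z - a) / \<theta>" using za th by (simp add: field_simps)
  also have "norm z * norm (z - a) \<le> norm (z - a) / \<theta>"
  proof -
    have "norm z * norm (z - a) \<le> 1 * norm (z - a)" using z1 by (intro mult_right_mono) auto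
    also have "\<dots> \<le> norm (z - a) / \<theta>" using th by (simp add: field_simps mult_left_le_one_le)
    finally show ?thesis .
  qed
  finally have "norm (1 - cnj a * z) \<le> 5/2 * (norm (z - a) / \<theta>) + norm (z - a) / \<theta>" by simp
  also have "\<dots> \<le> 4 * (norm (z - a) / \<theta>)"
    using divide_nonneg_pos[OF norm_ge_zero th(1), of "z - a"] by linarith
  finally have "\<theta> * norm (1 - cnj a * z) \<le> 4 * norm (z - a)" using th by (simp add: field_simps)
  moreover have "norm (1 - cnj a * z) > 0" using one_minus_cnj_mult_nz[of a z] a z1 by simp
  ultimately show ?thesis unfolding pseudo_dist_def by (simp add: field_simps)
qed

text \<open>Every zero in the Whitney disc of \<open>c\<close> thus contributes a fixed amount to
  the sum at \<open>c\<close>, which bounds the number of such zeros. The estimates give 2/25,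
  rounded down to 1/13.\<close>

lemma pseudo_dist_whitney_upper:
  assumes c: "norm c < 1" and a: "norm a < 1" and ac: "norm (a - c) \<le> (1 - norm c) / 2"
  shows "1 / 13 \<le> 1 - (pseudo_dist a c)\<^sup>2"
proof -
  define d where "d = 1 - norm c"
  have d: "0 < d" using c by (simp add: d_def)
  have na: "norm a \<le> norm c + norm (a - c)"
    by (metis add.commute diff_add_cancel norm_triangle_ineq)
  then have a2: "d / 2 \<le> 1 - norm a" using ac by (simp add: d_def)
  have eq: "1 - cnj a * c = of_real (1 - (norm c)\<^sup>2) + c * cnj (c - a)"
    by (simp add: algebra_simps complex_norm_square del: of_real_power)
  have "norm (1 - cnj a * c) \<le> \<bar>1 - (norm c)\<^sup>2\<bar> + norm c * norm (c - a)"
    unfolding eq by (rule order_trans[OF norm_triangle_ineq]) (simp only: norm_of_real norm_mult complex_mod_cnj order_refl)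
  also have "\<bar>1 - (norm c)\<^sup>2\<bar> = 1 - (norm c)\<^sup>2" using c by (simp add: power_le_one)
  also have "1 - (norm c)\<^sup>2 \<le> 2 * d"
    using zero_le_power2[of "1 - norm c"] by (simp add: power2_diff d_def)
  also have "norm c * norm (c - a) \<le> 1 * (d / 2)"
    using c ac by (intro mult_mono) (auto simp: norm_minus_commute d_def)
  finally have up: "norm (1 - cnj a * c) \<le> 5/2 * d" by simp
  have pos: "norm (1 - cnj a * c) > 0" using one_minus_cnj_mult_nz[of a c] a c by simp
  have "1/13 \<le> (d * (d / 2)) / (5/2 * d)\<^sup>2" using d by (simp add: power2_eq_square)
  also have "\<dots> \<le> ((1 - (norm c)\<^sup>2) * (1 - (norm a)\<^sup>2)) / (norm (1 - cnj a * c))\<^sup>2"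
  proof (rule frac_le)
    have "x\<^sup>2 \<le> x" if "0 \<le> x" "x \<le> 1" for x :: real
      using that by (simp add: power2_eq_square mult_left_le)
    then have *: "(norm c)\<^sup>2 \<le> norm c" "(norm a)\<^sup>2 \<le> norm a" using a c by simp_all
    show "d * (d / 2) \<le> (1 - (norm c)\<^sup>2) * (1 - (norm a)\<^sup>2)"
      using a2 * d by (intro mult_mono) (auto simp: d_def)
    show "0 \<le> (1 - (norm c)\<^sup>2) * (1 - (norm a)\<^sup>2)" using a c by (simp add: power_le_one)
    show "(norm (1 - cnj a * c))\<^sup>2 \<le> (5/2 * d)\<^sup>2" using up by (intro power_mono) auto
    show "0 < (norm (1 - cnj a * c))\<^sup>2" using pos by simp
  qed
  finally show ?thesis using one_minus_pseudo_dist_sq[OF a c] by simp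
qed

lemma radius_away_from_finite:
  fixes t :: "'a \<Rightarrow> real"
  assumes "finite J" "card J \<le> N"
  obtains s where "1/8 \<le> s" "s \<le> 1/4" "\<And>k. k \<in> J \<Longrightarrow> 1 / (16 * (real N + 1)) \<le> \<bar>t k - s\<bar>"
proof (rule ccontr)
  assume neg: "\<not> thesis"
  note choose = that
  \<comment> \<open>Pigeonhole: each element of \<open>J\<close> spoils at most one of the \<open>N + 1\<close> candidate radii.\<close>
  define s where "s = (\<lambda>j::nat. 1/8 + real j / (8 * (real N + 1)))"
  have "\<exists>k\<in>J. \<bar>t k - s j\<bar> < 1 / (16 * (real N + 1))" if "j \<le> N" for j
  proof (rule ccontr)
    assume "\<not> ?thesis"
    then have "\<And>k. k \<in> J \<Longrightarrow> 1 / (16 * (real N + 1)) \<le> \<bar>t k - s j\<bar>" by force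
    moreover have "1/8 \<le> s j" "s j \<le> 1/4" using that by (auto simp: s_def field_simps)
    ultimately show False using neg choose[of "s j"] by blast
  qed
  then obtain \<kappa> where \<kappa>: "\<And>j. j \<le> N \<Longrightarrow> \<kappa> j \<in> J"
    "\<And>j. j \<le> N \<Longrightarrow> \<bar>t (\<kappa> j) - s j\<bar> < 1 / (16 * (real N + 1))" by metis
  \<comment> \<open>Consecutive candidates are \<open>1 / (8 * (real N + 1))\<close> apart, twice
    the tolerance, so no element can spoil two of them.\<close>
  have "inj_on \<kappa> {..N}"
  proof (rule inj_onI)
    fix i j assume ij: "i \<in> {..N}" "j \<in> {..N}" "\<kappa> i = \<kappa> j"
    then have "\<bar>s i - s j\<bar> < 1 / (16 * (real N + 1)) + 1 / (16 * (real N + 1))"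
      using \<kappa>(2)[of i] \<kappa>(2)[of j] by simp
    also have "\<dots> = 1 / (8 * (real N + 1))" by (simp add: field_simps)
    finally have "\<bar>s i - s j\<bar> < 1 / (8 * (real N + 1))" .
    moreover have "s i - s j = (real i - real j) / (8 * (real N + 1))"
      by (simp add: s_def diff_divide_distrib)
    ultimately have "\<bar>real i - real j\<bar> < 1" by (simp add: abs_divide divide_less_cancel)
    then show "i = j" by linarith
  qed
  then have "card {..N} \<le> card J" using \<kappa>(1) assms(1) by (intro card_inj_on_le[of \<kappa>]) auto
  with assms(2) show False by simp
qed

text \<open>One such circle in each Whitney disc suffices to trap zeros: by the minimum modulus
  principle, a function uniformly close to \<open>f\<close> that is small at the centre must vanish inside.\<close>

definition circle_bounded_below :: "(complex \<Rightarrow> complex) \<Rightarrow> real \<Rightarrow> bool" where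
  "circle_bounded_below f d \<longleftrightarrow> (\<forall>c\<in>ball 0 1. \<exists>s. 0 < s \<and> s \<le> 1/2 \<and>
     (\<forall>z. norm (z - c) = s * (1 - norm c) \<longrightarrow> d \<le> norm (f z)))"

text \<open>At most \<open>N\<close> zeros, counted with repetition, lie in a Whitney disc, so some
  circle about its centre stays pseudohyperbolically away from all zeros. On that circle the bounded
  sum of \<open>1 - (pseudo_dist a z)\<^sup>2\<close> keeps the product away from 0.\<close>

lemma carleson_newman_circle_bounded_below:
  assumes hol: "b holomorphic_on ball 0 1" and cn: "carleson_newman b"
  obtains d where "d > 0" "circle_bounded_below b d"
proof -
  obtain I a where a: "\<And>k. norm (a k) < 1 \<or> k \<notin> I"
    and lim: "\<And>z. norm z < 1 \<Longrightarrow>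
      (\<lambda>m. \<Prod>k\<in>I \<inter> {..<m}. pseudo_dist (a k) z) \<longlonglongrightarrow> norm (b z)"
    and zeros: "\<And>z. norm z < 1 \<Longrightarrow> b z = 0 \<Longrightarrow> z \<in> a ` I"
    using cn blaschke_product_partial_products unfolding carleson_newman_def by metis
  \<comment> \<open>A function vanishing identically would make the whole disc a subset of the
    countable set of listed zeros.\<close>
  have "\<exists>w\<in>ball 0 1. b w \<noteq> 0"
  proof (rule ccontr)
    assume "\<not> ?thesis"
    then have "ball 0 1 \<subseteq> a ` I" using zeros by auto
    then have "countable (ball (0::complex) 1)" by (rule countable_subset) simp
    then show False using uncountable_ball[of 1 "0::complex"] by simp
  qed
  then obtain K where K: "K > 0" "\<And>c F. norm c < 1 \<Longrightarrow> finite F \<Longrightarrow> F \<subseteq> I \<Longrightarrow>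
      (\<Sum>k\<in>F. 1 - (pseudo_dist (a k) c)\<^sup>2) \<le> K"
    using carleson_newman_sum_bound[OF hol _ _ a lim] cn unfolding carleson_newman_def by metis
  \<comment> \<open>Each zero of the Whitney disc uses up at least 1/13 of the total
    \<open>K\<close>. The gap \<open>\<theta>\<close> below is the one left by \<open>N\<close>
    zeros, and \<open>d\<close> is the resulting bound on the product with all factors at least
    \<open>\<theta> / 4\<close>.\<close>
  define N where "N = nat \<lceil>13 * K\<rceil>"
  define \<theta> where "\<theta> = 1 / (16 * (real N + 1))"
  have \<theta>: "0 < \<theta>" "\<theta> \<le> 1/16" by (auto simp: \<theta>_def)
  define d where "d = exp (- K / (\<theta> / 4)\<^sup>2)"
  show thesis
  proof (rule that)
    show "d > 0" by (simp add: d_def)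
    show "circle_bounded_below b d"
      unfolding circle_bounded_below_def
    proof (intro ballI)
      fix c :: complex assume "c \<in> ball 0 1"
      then have c: "norm c < 1" by simp
      define J where "J = {k \<in> I. norm (a k - c) \<le> (1 - norm c) / 2}"
      have "card F \<le> N" if F: "F \<subseteq> J" "finite F" for F
      proof -
        have "real (card F) * (1/13) = (\<Sum>k\<in>F. 1/13)" by simp
        also have "\<dots> \<le> (\<Sum>k\<in>F. 1 - (pseudo_dist (a k) c)\<^sup>2)"
        proof (rule sum_mono)
          fix k assume "k \<in> F"
          then have "k \<in> J" using F by auto
          then show "1/13 \<le> 1 - (pseudo_dist (a k) c)\<^sup>2"
            using a[of k] c by (intro pseudo_dist_whitney_upper) (auto simp: J_def)
        qed
        also have "\<dots> \<le> K" using F by (intro K(2) c) (auto simp: J_def)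
        finally show ?thesis unfolding N_def by linarith
      qed
      then have J: "finite J" "card J \<le> N"
        using finite_if_finite_subsets_card_bdd[of J N] by blast+
      obtain s where s: "1/8 \<le> s" "s \<le> 1/4"
        "\<And>k. k \<in> J \<Longrightarrow> \<theta> \<le> \<bar>norm (a k - c) / (1 - norm c) - s\<bar>"
        by (rule radius_away_from_finite[OF J, of "\<lambda>k. norm (a k - c) / (1 - norm c)"])
           (auto simp: \<theta>_def)
      show "\<exists>s. 0 < s \<and> s \<le> 1/2 \<and> (\<forall>z. norm (z - c) = s * (1 - norm c) \<longrightarrow> d \<le> norm (b z))"
      proof (intro exI[of _ s] conjI allI impI)
        fix z assume z: "norm (z - c) = s * (1 - norm c)"
        have z4: "norm (z - c) \<le> (1 - norm c) / 4"
          unfolding z using s c mult_right_mono[of s "1/4" "1 - norm c"] by simp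
        have z1: "norm z < 1"
          using norm_triangle_ineq[of c "z - c"] z4 c by simp
        have tri: "\<bar>norm (a k - c) - norm (z - c)\<bar> \<le> norm (z - a k)" for k
          using norm_triangle_ineq3[of "a k - c" "z - c"] by (simp add: norm_minus_commute)
        have far: "\<theta> * (1 - norm c) \<le> norm (z - a k)" if "k \<in> I" for k
        proof (cases "k \<in> J")
          case True
          have "\<theta> * (1 - norm c) \<le> \<bar>norm (a k - c) / (1 - norm c) - s\<bar> * (1 - norm c)"
            using s(3)[OF True] c by (intro mult_right_mono) auto
          also have "\<dots> = \<bar>(norm (a k - c) / (1 - norm c) - s) * (1 - norm c)\<bar>"
            using c by (simp add: abs_mult)
          also have "(norm (a k - c) / (1 - norm c) - s) * (1 - norm c) = norm (a k - c) - norm (z - c)"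
            using c z by (simp add: left_diff_distrib)
          finally show ?thesis using tri[of k] by simp
        next
          case False
          then have "norm (a k - c) > (1 - norm c) / 2" using that by (simp add: J_def)
          with z4 have "1/4 * (1 - norm c) \<le> norm (z - a k)" using tri[of k] by simp
          moreover have "\<theta> * (1 - norm c) \<le> 1/4 * (1 - norm c)"
            using \<theta> c by (intro mult_right_mono) auto
          ultimately show ?thesis by simp
        qed
        show "d \<le> norm (b z)"
        proof (rule LIMSEQ_le_const[OF lim[OF z1]], intro exI allI impI)
          fix m :: nat
          define F where "F = I \<inter> {..<m}"
          have "d \<le> exp (- (\<Sum>k\<in>F. 1 - (pseudo_dist (a k) z)\<^sup>2) / (\<theta> / 4)\<^sup>2)"
            unfolding d_def using K(2)[OF z1, of F]
            by (simp add: F_def divide_right_mono)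
          also have "\<dots> \<le> (\<Prod>k\<in>F. pseudo_dist (a k) z)"
          proof (rule prod_ge_exp_sum)
            fix k assume "k \<in> F"
            then have k: "k \<in> I" "norm (a k) < 1" using a[of k] by (auto simp: F_def)
            show "\<theta> / 4 \<le> pseudo_dist (a k) z"
              by (rule pseudo_dist_whitney_lower[OF c k(2) z4 \<theta>(1) _ far[OF k(1)]]) (use \<theta> in simp)
            show "pseudo_dist (a k) z \<le> 1" by (rule pseudo_dist_le_1[OF k(2) z1])
          qed (use \<theta> in \<open>auto simp: F_def\<close>)
          finally show "d \<le> (\<Prod>k\<in>I \<inter> {..<m}. pseudo_dist (a k) z)" by (simp add: F_def)
        qed
      qed (use s in auto)
    qed
  qed
qed

text \<open>An invertible factor is bounded below on the disc by the reciprocal of the norm of its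
  inverse, so the bound for the Blaschke product survives on the same circles.\<close>

lemma CNstar_circle_bounded_below:
  assumes "f \<in> CNstar"
  obtains d where "d > 0" "circle_bounded_below (hinf_apply f) d"
proof -
  obtain b h k where bh: "f = b * h" "carleson_newman (hinf_apply b)" "1 = h * k"
    using assms by (auto simp: CNstar_def dvd_def)
  obtain d where d: "d > 0" "circle_bounded_below (hinf_apply b) d"
    using carleson_newman_circle_bounded_below[OF hinf_holomorphic bh(2)] by blast
  have k: "norm k > 0" using bh(3) by auto
  have hz: "1 / norm k \<le> norm (hinf_apply h z)" if z: "z \<in> unit_disc" for z
  proof -
    have "hinf_apply h z * hinf_apply k z = 1"
      using bh(3) z by (metis hinf_apply_one hinf_apply_ring(5))
    then have "1 = norm (hinf_apply h z) * norm (hinf_apply k z)" by (metis norm_mult norm_one)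
    also have "\<dots> \<le> norm (hinf_apply h z) * norm k"
      by (intro mult_left_mono norm_hinf_upper z) auto
    finally show ?thesis using k by (simp add: field_simps)
  qed
  show thesis
  proof (rule that)
    show "d / norm k > 0" using d k by simp
    show "circle_bounded_below (hinf_apply f) (d / norm k)"
      unfolding circle_bounded_below_def
    proof (intro ballI)
      fix c assume c: "c \<in> unit_disc"
      then obtain s where s: "0 < s" "s \<le> 1/2"
        "\<And>z. norm (z - c) = s * (1 - norm c) \<Longrightarrow> d \<le> norm (hinf_apply b z)"
        using d unfolding circle_bounded_below_def by blast
      show "\<exists>s. 0 < s \<and> s \<le> 1/2 \<and>
        (\<forall>z. norm (z - c) = s * (1 - norm c) \<longrightarrow> d / norm k \<le> norm (hinf_apply f z))"
      proof (intro exI[of _ s] conjI allI impI s)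
        fix z assume z: "norm (z - c) = s * (1 - norm c)"
        have "norm (z - c) \<le> 1/2 * (1 - norm c)"
          unfolding z using s c by (intro mult_right_mono) auto
        moreover have "norm z \<le> norm c + norm (z - c)"
          using norm_triangle_ineq[of c "z - c"] by simp
        moreover have "norm c < 1" using c by simp
        ultimately have "norm z < 1" by argo
        then have "z \<in> unit_disc" by simp
        have "d * (1 / norm k) \<le> norm (hinf_apply b z) * norm (hinf_apply h z)"
          using s(3)[OF z] hz[OF \<open>z \<in> unit_disc\<close>] d k by (intro mult_mono) auto
        then show "d / norm k \<le> norm (hinf_apply f z)" by (simp add: bh(1) norm_mult)
      qed
    qed
  qed
qed

section \<open>Inner functions that are not finite Blaschke products\<close>

text \<open>The zero is removed at its full order, and the local representation by
  \<open>zor_poly\<close> extends the quotient across \<open>a\<close>.\<close>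

lemma factor_out_zero:
  assumes hol: "u holomorphic_on ball 0 1" and a: "norm a < 1" "u a = 0"
    and nz: "\<exists>w\<in>ball 0 1. u w \<noteq> 0"
  obtains v n where "v holomorphic_on ball 0 1" "v a \<noteq> 0"
    "\<And>z. norm z < 1 \<Longrightarrow> u z = blaschke_factor a z ^ n * v z"
proof -
  define n where "n = nat (zorder u a)"
  define g where "g = zor_poly u a"
  have "(if u a = 0 then zorder u a > 0 else zorder u a = 0) \<and>
      (\<exists>r. r > 0 \<and> cball a r \<subseteq> ball 0 1 \<and> g holomorphic_on cball a r \<and>
        (\<forall>w\<in>cball a r. u w = g w * (w - a) ^ n \<and> g w \<noteq> 0))"
    unfolding g_def n_def by (rule zorder_exist_zero[OF hol _ _ _ nz]) (use a in auto)
  note zo = this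
  from zo a(2) have "n > 0" by (simp add: n_def)
  from zo obtain r where r: "r > 0" "cball a r \<subseteq> ball 0 1" "g holomorphic_on cball a r"
    "\<And>w. w \<in> cball a r \<Longrightarrow> u w = g w * (w - a) ^ n" "\<And>w. w \<in> cball a r \<Longrightarrow> g w \<noteq> 0"
    by blast
  \<comment> \<open>The zero-free cofactor of \<open>z - a\<close> in the Blaschke factor.\<close>
  define q where "q = (\<lambda>z. if a = 0 then 1 else - (of_real (norm a) / a) / (1 - cnj a * z))"
  have bf: "blaschke_factor a z = q z * (z - a)" for z
  proof (cases "a = 0")
    case False
    have "x * ((a - z) / d) = - x / d * (z - a)" for x d :: complex
      by (simp add: algebra_simps diff_divide_distrib)
    with False show ?thesis by (simp only: blaschke_factor_def q_def if_False)
  qed (simp add: blaschke_factor_def q_def)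
  have qnz: "q z \<noteq> 0" if "norm z < 1" for z
    using one_minus_cnj_mult_nz[of a z] that a by (auto simp: q_def)
  have qhol: "q holomorphic_on A" if "A \<subseteq> ball 0 1" for A
    unfolding q_def using one_minus_cnj_mult_nz[of a] that a
    by (cases "a = 0") (auto intro!: holomorphic_intros simp: subset_iff)
  define v where "v = (\<lambda>z. if z = a then g a / q a ^ n else u z / (q z ^ n * (z - a) ^ n))"
  have v_near: "v z = g z / q z ^ n" if "z \<in> ball a r" for z
    using r(4)[of z] that by (auto simp: v_def)
  show thesis
  proof (rule that[of v n])
    have "v holomorphic_on ball a r"
    proof (rule holomorphic_transform[of "\<lambda>z. g z / q z ^ n"])
      have sub: "ball a r \<subseteq> ball 0 1" using r(2) by auto
      then have "q z ^ n \<noteq> 0" if "z \<in> ball a r" for z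
        using that qnz[of z] by auto
      then show "(\<lambda>z. g z / q z ^ n) holomorphic_on ball a r"
        using sub by (intro holomorphic_intros holomorphic_on_subset[OF r(3)] qhol) auto
    qed (simp add: v_near)
    moreover have "v holomorphic_on ball 0 1 - {a}"
    proof (rule holomorphic_transform[of "\<lambda>z. u z / (q z ^ n * (z - a) ^ n)"])
      show "(\<lambda>z. u z / (q z ^ n * (z - a) ^ n)) holomorphic_on ball 0 1 - {a}"
        by (intro holomorphic_intros holomorphic_on_subset[OF hol] qhol) (auto dest: qnz)
    qed (simp add: v_def)
    \<comment> \<open>Holomorphy is glued from two open sets, a ball about \<open>a\<close> and the
      disc punctured at \<open>a\<close>.\<close>
    ultimately have "v holomorphic_on ball a r \<union> (ball 0 1 - {a})"
      by (intro holomorphic_on_Un) (auto intro: open_delete)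
    then show "v holomorphic_on ball 0 1"
      by (rule holomorphic_on_subset) (use r(1) in auto)
    show "v a \<noteq> 0" using r(1) r(5)[of a] qnz[OF a(1)] by (simp add: v_def)
    fix z :: complex assume z: "norm z < 1"
    show "u z = blaschke_factor a z ^ n * v z"
    proof (cases "z = a")
      case True
      then show ?thesis using \<open>n > 0\<close> a by (simp add: bf)
    next
      case False
      then show ?thesis using qnz[OF z] by (simp add: bf v_def power_mult_distrib)
    qed
  qed
qed

text \<open>Induction on the number of distinct zeros: each step removes one zero at its full
  multiplicity, so the count drops by exactly one.\<close>

lemma finite_zeros_factorization:
  assumes "finite {z \<in> ball 0 1. u z = 0}" "u holomorphic_on ball 0 1"
    and "\<exists>w\<in>ball 0 1. u w \<noteq> (0::complex)"
  shows "\<exists>v N a. v holomorphic_on ball 0 1 \<and> (\<forall>z\<in>ball 0 1. v z \<noteq> 0) \<and>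
    (\<forall>k<(N::nat). norm (a k) < 1) \<and>
    (\<forall>z\<in>ball 0 1. u z = (\<Prod>k<N. blaschke_factor (a k) z) * v z)"
  using assms
proof (induction "card {z \<in> ball 0 1. u z = 0}" arbitrary: u)
  case 0
  then have "\<forall>z\<in>ball 0 1. u z \<noteq> 0" by auto
  with 0 show ?case by (intro exI[of _ u] exI[of _ 0]) auto
next
  case (Suc m)
  have "{z \<in> ball 0 1. u z = 0} \<noteq> {}" using Suc.hyps(2) by (metis card.empty nat.distinct(1))
  then obtain a where a: "norm a < 1" "u a = 0" by auto
  obtain v n where v: "v holomorphic_on ball 0 1" "v a \<noteq> 0"
    "\<And>z. norm z < 1 \<Longrightarrow> u z = blaschke_factor a z ^ n * v z"
    using factor_out_zero[OF Suc.prems(2) a Suc.prems(3)] by blast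
  have "{z \<in> ball 0 1. v z = 0} = {z \<in> ball 0 1. u z = 0} - {a}"
    using v(2,3) a by (auto simp: blaschke_factor_eq_0_iff)
  then have "m = card {z \<in> ball 0 1. v z = 0}" "finite {z \<in> ball 0 1. v z = 0}"
    using Suc.hyps(2) Suc.prems(1) a by (simp_all add: card_Diff_singleton_if)
  moreover have "\<exists>w\<in>ball 0 1. v w \<noteq> 0" using v(2) a by auto
  ultimately obtain w N c where w: "w holomorphic_on ball 0 1" "\<forall>z\<in>ball 0 1. w z \<noteq> 0"
    "\<forall>k<(N::nat). norm (c k) < 1" "\<forall>z\<in>ball 0 1. v z = (\<Prod>k<N. blaschke_factor (c k) z) * w z"
    using Suc.hyps(1)[of v] v(1) by blast
  define c' where "c' = (\<lambda>k. if k < N then c k else a)"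
  have prod: "(\<Prod>k<N + n. blaschke_factor (c' k) z) =
      (\<Prod>k<N. blaschke_factor (c k) z) * blaschke_factor a z ^ n" for z
  proof -
    have "(\<Prod>k<N + n. blaschke_factor (c' k) z) =
        (\<Prod>k<N. blaschke_factor (c' k) z) * (\<Prod>k<n. blaschke_factor (c' (N + k)) z)"
      by (induction n) (auto simp: mult_ac)
    then show ?thesis by (simp add: c'_def)
  qed
  have "norm (c' k) < 1" for k using w(3) a by (simp add: c'_def)
  moreover have "u z = (\<Prod>k<N + n. blaschke_factor (c' k) z) * w z" if "z \<in> ball 0 1" for z
    unfolding prod using w(4) v(3)[of z] that by simp
  ultimately show ?case using w(1,2) by blast
qed

text \<open>For \<open>cis t\<close> on the circle,
  \<open>norm (1 - cnj a * cis t) = norm (cis t - a)\<close>, so each factor is continuous up to the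
  circle with modulus 1 there.\<close>

lemma tendsto_norm_finite_blaschke_radial:
  assumes "\<And>k. k < N \<Longrightarrow> norm (a k) < 1"
  shows "((\<lambda>r. norm (\<Prod>k<(N::nat). blaschke_factor (a k) (of_real r * cis t))) \<longlongrightarrow> 1) (at_left 1)"
proof -
  have "((\<lambda>r. pseudo_dist (a k) (of_real r * cis t)) \<longlongrightarrow> 1) (at_left 1)" if "k < N" for k
  proof -
    have nz: "1 - cnj (a k) * cis t \<noteq> 0"
      using one_minus_cnj_mult_nz[of "a k" "cis t"] assms[OF that] by simp
    have "1 - cnj (a k) * cis t = cis t * cnj (cis t - a k)"
      by (simp add: algebra_simps cis_cnj cis_mult)
    then have "norm (1 - cnj (a k) * cis t) = norm (cis t - a k)"
      by (metis complex_mod_cnj mult_1 norm_cis norm_mult)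
    moreover have "norm (1 - cnj (a k) * cis t) \<noteq> 0" using nz by simp
    ultimately have one: "norm (of_real 1 * cis t - a k) / norm (1 - cnj (a k) * (of_real 1 * cis t)) = 1"
      by (simp only: of_real_1 mult_1) simp
    have "((\<lambda>r. norm (of_real r * cis t - a k) / norm (1 - cnj (a k) * (of_real r * cis t))) \<longlongrightarrow>
       norm (of_real 1 * cis t - a k) / norm (1 - cnj (a k) * (of_real 1 * cis t))) (at_left 1)"
      by (intro tendsto_intros) (use nz in auto)
    then show ?thesis unfolding one pseudo_dist_def .
  qed
  then have "((\<lambda>r. \<Prod>k<N. pseudo_dist (a k) (of_real r * cis t)) \<longlongrightarrow> (\<Prod>k<N. 1)) (at_left 1)"
    by (intro tendsto_prod) auto
  then show ?thesis by (simp add: prod_norm[symmetric] norm_blaschke_factor)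
qed

section \<open>Bounded functions with unimodular radial limits\<close>

lemma eventually_radial_in_disc:
  assumes "r0 < 1"
  shows "\<forall>\<^sub>F r in at_left (1::real). max 0 r0 < r \<and> r < 1"
  using eventually_at_left_real[of "max 0 r0" 1] assms by simp

text \<open>The subharmonic function \<open>max 1 (norm f) - 1\<close> is bounded with radial limits
  0 almost everywhere, so it vanishes.\<close>

lemma norm_le_1_radial:
  assumes f: "f holomorphic_on ball 0 1" and bdd: "\<And>z. norm z < 1 \<Longrightarrow> norm (f z) \<le> M"
    and rad: "AE t in lebesgue_on {0..2 * pi}. ((\<lambda>r. norm (f (of_real r * cis t))) \<longlongrightarrow> 1) (at_left 1)"
    and x: "norm x < 1"
  shows "norm (f x) \<le> 1"
proof -
  have "max 1 (norm (f x)) - 1 = 0"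
  proof (rule touching_subharmonic_radial_zero[OF touching_subharmonic_max_norm[OF f open_ball] _ _ _ x])
    show "AE t in lebesgue_on {0..2 * pi}.
        ((\<lambda>r. max 1 (norm (f (of_real r * cis t))) - 1) \<longlongrightarrow> 0) (at_left 1)"
      using rad
    proof eventually_elim
      case (elim t)
      have "((\<lambda>r. max 1 (norm (f (of_real r * cis t))) - 1) \<longlongrightarrow> max 1 1 - 1) (at_left 1)"
        by (intro tendsto_intros elim)
      then show ?case by simp
    qed
    show "max 1 (norm (f z)) - 1 \<le> max 1 M" if "norm z < 1" for z
      using bdd[OF that] by linarith
  qed auto
  then show ?thesis by simp
qed

text \<open>The preceding bound applies to \<open>f\<close> and to \<open>1 / f\<close>, so the
  modulus is identically 1 and the maximum modulus principle finishes.\<close>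

lemma unimodular_radial_constant:
  assumes f: "f holomorphic_on ball 0 1" and bdd: "\<And>z. norm z < 1 \<Longrightarrow> norm (f z) \<le> M"
    and low: "\<And>z. norm z < 1 \<Longrightarrow> m \<le> norm (f z)" "m > 0"
    and rad: "AE t in lebesgue_on {0..2 * pi}. ((\<lambda>r. norm (f (of_real r * cis t))) \<longlongrightarrow> 1) (at_left 1)"
  obtains c where "norm c = 1" "\<And>z. norm z < 1 \<Longrightarrow> f z = c"
proof -
  have nz: "f z \<noteq> 0" if "norm z < 1" for z using low(1)[OF that] low(2) by auto
  have le: "norm (f z) \<le> 1" if "norm z < 1" for z
    by (rule norm_le_1_radial[OF f bdd rad that])
  have ge: "norm (1 / f z) \<le> 1" if "norm z < 1" for z
  proof (rule norm_le_1_radial[OF _ _ _ that, of "\<lambda>z. 1 / f z"])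
    show "(\<lambda>z. 1 / f z) holomorphic_on ball 0 1"
      by (intro holomorphic_intros f) (use nz in auto)
    show "norm (1 / f z) \<le> 1 / m" if "norm z < 1" for z
      using low(1)[OF that] low(2) by (simp add: norm_divide frac_le)
    show "AE t in lebesgue_on {0..2 * pi}. ((\<lambda>r. norm (1 / f (of_real r * cis t))) \<longlongrightarrow> 1) (at_left 1)"
      using rad
    proof eventually_elim
      case (elim t)
      have "((\<lambda>r. 1 / norm (f (of_real r * cis t))) \<longlongrightarrow> 1 / 1) (at_left 1)"
        by (intro tendsto_intros elim) auto
      then show ?case by (simp add: norm_divide)
    qed
  qed
  have eq1: "norm (f z) = 1" if "norm z < 1" for z
    using le[OF that] ge[OF that] nz[OF that] by (simp add: norm_divide field_simps)
  have "f constant_on ball 0 1"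
    by (rule maximum_modulus_principle[OF f open_ball connected_ball open_ball, of 0 1 0]) (auto simp: eq1)
  then obtain c where "\<And>z. z \<in> ball 0 1 \<Longrightarrow> f z = c" by (auto simp: constant_on_def)
  then show thesis using that[of c] eq1[of 0] by auto
qed

text \<open>Otherwise the zeros lie in a smaller closed disc and are finite in number. Dividing by
  their Blaschke product \<open>B\<close> leaves a function \<open>v\<close> bounded above and below
  with unimodular radial limits, hence a constant.\<close>

lemma inner_small_near_boundary:
  assumes inner: "inner_function u" and nfb: "\<not> finite_blaschke_product u"
    and r: "r < 1" and e: "e > 0"
  obtains z where "r < norm z" "norm z < 1" "norm (u z) < e"
proof (rule ccontr)
  assume "\<not> thesis"
  with that have low: "\<And>z. r < norm z \<Longrightarrow> norm z < 1 \<Longrightarrow> e \<le> norm (u z)"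
    by (meson not_le)
  have hol: "u holomorphic_on ball 0 1" using inner by (simp add: inner_function_def)
  have "bounded (u ` ball 0 1)" using inner by (simp add: inner_function_def)
  then obtain M where "\<forall>x\<in>u ` ball 0 1. norm x \<le> M" unfolding bounded_iff by blast
  then have M: "norm (u z) \<le> M" if "norm z < 1" for z using that by simp
  define \<rho> where "\<rho> = max 0 r"
  have \<rho>: "0 \<le> \<rho>" "\<rho> < 1" "r \<le> \<rho>" using r by (auto simp: \<rho>_def)
  define x0 where "x0 = (of_real ((\<rho> + 1) / 2) :: complex)"
  have x0: "\<rho> < norm x0" "norm x0 < 1" using \<rho> by (simp_all add: x0_def)
  have ux0: "u x0 \<noteq> 0" using low[of x0] x0 \<rho> e by auto
  have nz: "\<exists>w\<in>ball 0 1. u w \<noteq> 0" using x0 ux0 by auto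
  have fin: "finite {z \<in> ball 0 1. u z = 0}"
  proof -
    have "finite {z \<in> cball 0 \<rho>. u z = 0}"
    proof (cases "u constant_on ball 0 1")
      case True
      then have "u z = u x0" if "z \<in> cball 0 \<rho>" for z
        using that x0 \<rho> by (force simp: constant_on_def)
      then have "{z \<in> cball 0 \<rho>. u z = 0} = {}" using ux0 by auto
      then show ?thesis by (metis finite.emptyI)
    next
      case False
      then show ?thesis
        by (intro holomorphic_compact_finite_zeros[OF hol]) (use \<rho> in auto)
    qed
    moreover have "{z \<in> ball 0 1. u z = 0} \<subseteq> {z \<in> cball 0 \<rho>. u z = 0}"
      using low e \<rho> by (force simp: not_le)
    ultimately show ?thesis by (rule rev_finite_subset)
  qed
  obtain v N a where v: "v holomorphic_on ball 0 1" "\<And>z. norm z < 1 \<Longrightarrow> v z \<noteq> 0"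
    and a: "\<And>k. k < (N::nat) \<Longrightarrow> norm (a k) < 1"
    and uv: "\<And>z. norm z < 1 \<Longrightarrow> u z = (\<Prod>k<N. blaschke_factor (a k) z) * v z"
    using finite_zeros_factorization[OF fin hol nz] by (auto simp: Ball_def)
  define B where "B = (\<lambda>z. \<Prod>k<N. blaschke_factor (a k) z)"
  have B1: "norm (B z) \<le> 1" if "norm z < 1" for z
    unfolding B_def prod_norm[symmetric] norm_blaschke_factor
    by (rule prod_le_1) (use a that in \<open>auto intro: pseudo_dist_le_1\<close>)
  have uvn: "norm (u z) = norm (B z) * norm (v z)" if "norm z < 1" for z
    using uv[OF that] by (simp add: B_def norm_mult)
  have contv: "continuous_on (ball 0 1) v" using v(1) by (rule holomorphic_on_imp_continuous_on)
  have v_low: "norm (u z) \<le> norm (v z)" if "norm z < 1" for z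
    unfolding uvn[OF that] by (rule mult_left_le_one_le) (use B1[OF that] in auto)
  define R where "R = (\<rho> + 1) / 2"
  have R: "\<rho> < R" "R < 1" "0 < R" using \<rho> by (auto simp: R_def)
  have contR: "continuous_on (cball 0 R) (\<lambda>z. norm (v z))"
    by (intro continuous_on_norm continuous_on_subset[OF contv]) (use R in auto)
  obtain y where y: "y \<in> cball 0 R" "\<And>z. z \<in> cball 0 R \<Longrightarrow> norm (v y) \<le> norm (v z)"
    using continuous_attains_inf[OF compact_cball _ contR] R
    by (metis cball_eq_empty not_less_iff_gr_or_eq)
  have radu: "AE t in lebesgue_on {0..2 * pi}. ((\<lambda>r. norm (u (of_real r * cis t))) \<longlongrightarrow> 1) (at_left 1)"
  proof -
    have "AE t in lebesgue_on {0..2 * pi}. \<exists>w. norm w = 1 \<and> ((\<lambda>r. u (of_real r * cis t)) \<longlongrightarrow> w) (at_left 1)"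
      using inner by (simp add: inner_function_def)
    then show ?thesis by eventually_elim (metis tendsto_norm)
  qed
  \<comment> \<open>All zeros satisfy \<open>norm (a k) \<le> \<rho>\<close>, so outside radius
    \<open>R\<close> each factor of \<open>B\<close> is bounded below. This bounds \<open>v\<close>
    above near the circle; on \<open>cball 0 R\<close> compactness does.\<close>
  have B_low: "((R - \<rho>) / 2) ^ N \<le> norm (B z)" if z: "R < norm z" "norm z < 1" for z
  proof -
    have "(\<Prod>k<N. (R - \<rho>) / 2) \<le> (\<Prod>k<N. pseudo_dist (a k) z)"
    proof (rule prod_mono)
      fix k assume "k \<in> {..<N}"
      then have k: "norm (a k) < 1" "u (a k) = 0"
        using a[of k] uv[of "a k"] by (auto simp: blaschke_factor_eq_0_iff intro!: bexI[of _ k])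
      then have "norm (a k) \<le> \<rho>" using low[of "a k"] e \<rho> by force
      then have "R - \<rho> \<le> norm (z - a k)" using z norm_triangle_ineq2[of z "a k"] by simp
      moreover have "norm (1 - cnj (a k) * z) \<le> 2"
      proof -
        have "norm (a k) * norm z \<le> 1 * 1" using k z by (intro mult_mono) auto
        then show ?thesis
          using norm_triangle_ineq4[of 1 "cnj (a k) * z"] by (simp add: norm_mult)
      qed
      moreover have "norm (1 - cnj (a k) * z) > 0"
        using one_minus_cnj_mult_nz[of "a k" z] k z by simp
      ultimately show "0 \<le> (R - \<rho>) / 2 \<and> (R - \<rho>) / 2 \<le> pseudo_dist (a k) z"
        using R unfolding pseudo_dist_def by (intro conjI frac_le) auto
    qed
    then show ?thesis by (simp add: B_def prod_norm[symmetric] norm_blaschke_factor)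
  qed
  obtain y' where y': "\<And>z. z \<in> cball 0 R \<Longrightarrow> norm (v z) \<le> norm (v y')"
    using continuous_attains_sup[OF compact_cball _ contR] R
    by (metis cball_eq_empty not_less_iff_gr_or_eq)
  define K where "K = ((R - \<rho>) / 2) ^ N"
  have K: "K > 0" using R by (simp add: K_def)
  obtain c where c: "norm c = 1" "\<And>z. norm z < 1 \<Longrightarrow> v z = c"
  proof (rule unimodular_radial_constant[OF v(1)])
    show "AE t in lebesgue_on {0..2 * pi}. ((\<lambda>r. norm (v (of_real r * cis t))) \<longlongrightarrow> 1) (at_left 1)"
      using radu
    proof eventually_elim
      case (elim t)
      have "((\<lambda>r. norm (u (of_real r * cis t)) / norm (B (of_real r * cis t))) \<longlongrightarrow> 1 / 1) (at_left 1)"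
        unfolding B_def by (intro tendsto_intros elim tendsto_norm_finite_blaschke_radial a) auto
      moreover have "\<forall>\<^sub>F r in at_left 1. norm (u (of_real r * cis t)) / norm (B (of_real r * cis t)) =
          norm (v (of_real r * cis t))"
        using eventually_radial_in_disc[OF \<rho>(2)]
      proof eventually_elim
        case (elim s)
        then have s: "norm (of_real s * cis t) < 1" "r < norm (of_real s * cis t)"
          using \<rho> by (auto simp: norm_mult)
        have "u (of_real s * cis t) \<noteq> 0" using low[OF s(2,1)] e by auto
        then have "B (of_real s * cis t) \<noteq> 0" using uv[OF s(1)] by (auto simp: B_def)
        then show ?case using uvn[OF s(1)] by simp
      qed
      ultimately show ?case using Lim_transform_eventually by force
    qed
    show "0 < min e (norm (v y))" using e v(2)[of y] y(1) R by auto
    show "min e (norm (v y)) \<le> norm (v z)" if "norm z < 1" for z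
    proof (cases "norm z \<le> R")
      case True with y(2)[of z] show ?thesis by simp
    next
      case False
      with low[of z] v_low[OF that] that R \<rho> show ?thesis by simp
    qed
    show "norm (v z) \<le> max (norm (v y')) (M / K)" if "norm z < 1" for z
    proof (cases "norm z \<le> R")
      case True with y'[of z] show ?thesis by simp
    next
      case False
      have "K * norm (v z) \<le> norm (B z) * norm (v z)"
        using B_low[of z] False that by (intro mult_right_mono) (auto simp: K_def)
      also have "\<dots> \<le> M" using M[OF that] uvn[OF that] by simp
      finally have "norm (v z) \<le> M / K" using K by (simp add: field_simps)
      then show ?thesis by simp
    qed
  qed (rule that)
  have "finite_blaschke_product u"
    unfolding finite_blaschke_product_def
    by (rule exI[of _ c], rule exI[of _ N], rule exI[of _ a]) (use c a uv in \<open>auto simp: mult.commute\<close>)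
  with nfb show False ..
qed

section \<open>Zeros along a component\<close>

text \<open>On a Whitney disc of radius \<open>s = (1 - norm a) / 2\<close> the derivative is at
  most \<open>c / s\<close>, so \<open>u\<close> changes by at most \<open>c\<close>.\<close>

lemma little_bloch_whitney:
  assumes u: "little_bloch u" and c: "c > 0"
  obtains r where "r < 1"
    "\<And>a z. r < norm a \<Longrightarrow> norm a < 1 \<Longrightarrow> norm (z - a) \<le> (1 - norm a) / 2 \<Longrightarrow> norm (u z - u a) \<le> c"
proof -
  have hol: "u holomorphic_on ball 0 1" using u by (simp add: little_bloch_def)
  have "\<forall>\<^sub>F z in filtercomap norm (at_left 1). (1 - (norm z)\<^sup>2) * norm (deriv u z) < c"
    using u c by (auto simp: little_bloch_def intro: order_tendstoD)
  then obtain b where b: "b < 1"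
    "\<And>z. b < norm z \<Longrightarrow> norm z < 1 \<Longrightarrow> (1 - (norm z)\<^sup>2) * norm (deriv u z) < c"
    unfolding eventually_filtercomap eventually_at_left_field by blast
  show thesis
  \<comment> \<open>The threshold solves \<open>norm a - (1 - norm a) / 2 = b\<close>: beyond it the
    whole Whitney disc lies outside radius \<open>b\<close>.\<close>
  proof (rule that[of "(2 * b + 1) / 3"])
    show "(2 * b + 1) / 3 < 1" using b by simp
    fix a z :: complex
    assume a: "(2 * b + 1) / 3 < norm a" "norm a < 1" and z: "norm (z - a) \<le> (1 - norm a) / 2"
    define s where "s = (1 - norm a) / 2"
    have s: "s > 0" using a by (simp add: s_def)
    have in_disc: "b < norm w" "norm w < 1" "s \<le> 1 - norm w" if "w \<in> cball a s" for w
    proof -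
      have "\<bar>norm w - norm a\<bar> \<le> s"
        using that norm_triangle_ineq3[of w a] by (simp add: dist_norm norm_minus_commute)
      then show "b < norm w" "norm w < 1" "s \<le> 1 - norm w" using a unfolding s_def by argo+
    qed
    have "norm (u z - u a) \<le> (c / s) * norm (z - a)"
    proof (rule field_differentiable_bound[where S = "cball a s" and f' = "deriv u"])
      fix w assume w: "w \<in> cball a s"
      show "(u has_field_derivative deriv u w) (at w within cball a s)"
        using holomorphic_derivI[OF hol open_ball, of w] in_disc(2)[OF w]
        by (auto intro: has_field_derivative_at_within)
      have "s * norm (deriv u w) \<le> (1 - (norm w)\<^sup>2) * norm (deriv u w)"
      proof (rule mult_right_mono)
        have "(norm w)\<^sup>2 \<le> norm w"
          using in_disc(2)[OF w] by (simp add: power2_eq_square mult_left_le)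
        then show "s \<le> 1 - (norm w)\<^sup>2" using in_disc(3)[OF w] by simp
      qed simp
      also have "\<dots> < c" by (rule b(2)) (use in_disc[OF w] in auto)
      finally show "norm (deriv u w) \<le> c / s" using s by (simp add: field_simps)
    qed (use z s in \<open>auto simp: s_def dist_norm norm_minus_commute\<close>)
    also have "\<dots> \<le> (c / s) * s" using z c s by (intro mult_left_mono) (auto simp: s_def)
    finally show "norm (u z - u a) \<le> c" using s by simp
  qed
qed

text \<open>Encodes that the upper limit of \<open>norm u\<close> along the zeros of
  \<open>f\<close> towards the circle is at most \<open>c\<close>; it holds vacuously if the zeros
  do not approach the circle.\<close>

definition small_on_zeros :: "(complex \<Rightarrow> complex) \<Rightarrow> real \<Rightarrow> (complex \<Rightarrow> complex) \<Rightarrow> bool" where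
  "small_on_zeros u c f \<longleftrightarrow>
     (\<forall>c'>c. \<exists>r<1. \<forall>a. r < norm a \<and> norm a < 1 \<and> f a = 0 \<longrightarrow> norm (u a) < c')"

text \<open>Half of the slack \<open>c' - c\<close> pays for the upper limit along the zeros of
  \<open>f\<close>, the other half for the oscillation of \<open>u\<close> on Whitney discs.\<close>

lemma small_on_zeros_transfer:
  assumes u: "little_bloch u" and f: "small_on_zeros u c f"
    and near: "\<And>a. norm a < 1 \<Longrightarrow> g a = 0 \<Longrightarrow> \<exists>a'. norm (a' - a) \<le> (1 - norm a) / 2 \<and> f a' = 0"
  shows "small_on_zeros u c g"
  unfolding small_on_zeros_def
proof (intro allI impI)
  fix c' assume c': "c < c'"
  then have "c < (c + c') / 2" by simp
  with f obtain r1 where r1: "r1 < 1"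
    "\<And>a. r1 < norm a \<Longrightarrow> norm a < 1 \<Longrightarrow> f a = 0 \<Longrightarrow> norm (u a) < (c + c') / 2"
    unfolding small_on_zeros_def by blast
  obtain r2 where r2: "r2 < 1"
    "\<And>a z. r2 < norm a \<Longrightarrow> norm a < 1 \<Longrightarrow> norm (z - a) \<le> (1 - norm a) / 2 \<Longrightarrow> norm (u z - u a) \<le> (c' - c) / 2"
    using little_bloch_whitney[OF u, of "(c' - c) / 2"] c' by auto
  show "\<exists>r<1. \<forall>a. r < norm a \<and> norm a < 1 \<and> g a = 0 \<longrightarrow> norm (u a) < c'"
  proof (intro exI[of _ "max r2 ((2 * r1 + 1) / 3)"] conjI allI impI)
    fix a assume a: "max r2 ((2 * r1 + 1) / 3) < norm a \<and> norm a < 1 \<and> g a = 0"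
    then obtain a' where a': "norm (a' - a) \<le> (1 - norm a) / 2" "f a' = 0" using near by blast
    have "\<bar>norm a' - norm a\<bar> \<le> (1 - norm a) / 2"
      using a'(1) norm_triangle_ineq3[of a' a] by simp
    moreover have "(2 * r1 + 1) / 3 < norm a" "norm a < 1" using a by auto
    ultimately have "r1 < norm a'" "norm a' < 1" by argo+
    then have "norm (u a') < (c + c') / 2" using r1 a' by blast
    moreover have "norm (u a' - u a) \<le> (c' - c) / 2" using r2 a a' by simp
    moreover have "norm (u a) \<le> norm (u a') + norm (u a' - u a)"
      using norm_triangle_ineq2[of "u a" "u a'"] by (simp add: norm_minus_commute)
    ultimately show "norm (u a) < c'" by argo
  qed (use r1 r2 in auto)
qed

text \<open>On the good circle \<open>norm G\<close> exceeds \<open>d - e\<close>, which is at least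
  \<open>e\<close>, while \<open>norm (G a) < e\<close>. The case \<open>F = G\<close> is also
  used.\<close>

lemma circle_bounded_below_zero:
  assumes F: "circle_bounded_below F d" and G: "G holomorphic_on ball 0 1"
    and close: "\<And>z. norm z < 1 \<Longrightarrow> norm (F z - G z) < e" and e: "0 < e" "2 * e \<le> d"
    and a: "norm a < 1" "norm (G a) < e"
  obtains a' where "norm (a' - a) \<le> (1 - norm a) / 2" "G a' = 0"
proof -
  obtain s where s: "0 < s" "s \<le> 1/2"
    "\<And>z. norm (z - a) = s * (1 - norm a) \<Longrightarrow> d \<le> norm (F z)"
    using F a unfolding circle_bounded_below_def by (auto simp: Ball_def)
  define t where "t = s * (1 - norm a)"
  have "t \<le> 1/2 * (1 - norm a)"
    unfolding t_def using s a by (intro mult_right_mono) auto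
  then have t: "0 < t" "t \<le> (1 - norm a) / 2" using s a by (auto simp: t_def)
  have sub: "cball a t \<subseteq> ball 0 1"
  proof
    fix z assume "z \<in> cball a t"
    then have "norm z - norm a \<le> t"
      using norm_triangle_ineq2[of z a] by (simp add: dist_norm norm_minus_commute)
    then show "z \<in> ball 0 1" using t a by simp
  qed
  obtain b where "norm (b - a) < t" "G b = 0"
  proof (rule min_modulus_zero[OF G sub t(1) e(1) _ a(2)])
    fix z assume z: "norm (z - a) = t"
    then have "norm z < 1" using sub by (auto simp: subset_iff dist_norm norm_minus_commute)
    then have "norm (F z - G z) < e" by (rule close)
    moreover have "d \<le> norm (F z)" using s(3) z by (simp add: t_def)
    ultimately show "e \<le> norm (G z)" using norm_triangle_ineq2[of "F z" "G z"] e by simp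
  qed (rule that)
  with t that show thesis by force
qed

lemma small_on_zeros_locally_constant:
  assumes u: "little_bloch u" and f: "f \<in> CNstar"
  obtains e where "e > 0" "\<And>g. dist f g < e \<Longrightarrow>
    small_on_zeros u c (hinf_apply g) \<longleftrightarrow> small_on_zeros u c (hinf_apply f)"
proof -
  obtain d where d: "d > 0" "circle_bounded_below (hinf_apply f) d"
    using CNstar_circle_bounded_below[OF f] by blast
  show thesis
  proof (rule that[of "d / 2"])
    fix g assume g: "dist f g < d / 2"
    have close: "norm (hinf_apply f z - hinf_apply g z) < d / 2" if "norm z < 1" for z
    proof -
      have "norm (hinf_apply (f - g) z) \<le> norm (f - g)" by (rule norm_hinf_upper) (use that in simp)
      then show ?thesis using g by (simp add: dist_norm)
    qed
    have 1: "\<exists>a'. norm (a' - a) \<le> (1 - norm a) / 2 \<and> hinf_apply g a' = 0"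
      if a: "norm a < 1" "hinf_apply f a = 0" for a
    proof -
      have "norm (hinf_apply g a) < d / 2" using close[OF a(1)] a(2) by simp
      from circle_bounded_below_zero[OF d(2) hinf_holomorphic close _ _ a(1) this] d(1)
      show ?thesis by auto
    qed
    \<comment> \<open>Here \<open>f\<close> serves as both functions in the trapping lemma:
      \<open>f\<close> is small at a zero of \<open>g\<close>, so it has a zero of its own nearby.
      No circle bound for \<open>g\<close> is required.\<close>
    have 2: "\<exists>a'. norm (a' - a) \<le> (1 - norm a) / 2 \<and> hinf_apply f a' = 0"
      if a: "norm a < 1" "hinf_apply g a = 0" for a
    proof -
      have "norm (hinf_apply f a) < d / 2" using close[OF a(1)] a(2) by simp
      from circle_bounded_below_zero[OF d(2) hinf_holomorphic _ _ _ a(1) this] d(1)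
      show ?thesis by auto
    qed
    show "small_on_zeros u c (hinf_apply g) \<longleftrightarrow> small_on_zeros u c (hinf_apply f)"
      using small_on_zeros_transfer[OF u _ 1] small_on_zeros_transfer[OF u _ 2] by blast
  qed (use d in simp)
qed

text \<open>A locally constant property is constant on a connected set; \<open>c\<close> is fixed
  throughout.\<close>

lemma small_on_zeros_component:
  assumes u: "little_bloch u" and \<Omega>: "\<Omega> \<in> components CNstar" and fg: "f \<in> \<Omega>" "g \<in> \<Omega>"
    and f: "small_on_zeros u c (hinf_apply f)"
  shows "small_on_zeros u c (hinf_apply g)"
proof (rule connected_induction_simple[where P = "\<lambda>f. small_on_zeros u c (hinf_apply f)", OF _ fg f])
  show "connected \<Omega>" using \<Omega> by (rule in_components_connected)
  fix h assume h: "h \<in> \<Omega>"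
  then have "h \<in> CNstar" using in_components_subset[OF \<Omega>] by blast
  then obtain e where e: "e > 0" "\<And>g. dist h g < e \<Longrightarrow>
      small_on_zeros u c (hinf_apply g) \<longleftrightarrow> small_on_zeros u c (hinf_apply h)"
    using small_on_zeros_locally_constant[OF u] by metis
  show "\<exists>T. openin (top_of_set \<Omega>) T \<and> h \<in> T \<and> (\<forall>x\<in>T. \<forall>y\<in>T.
      small_on_zeros u c (hinf_apply x) \<longrightarrow> small_on_zeros u c (hinf_apply y))"
  proof (intro exI[of _ "\<Omega> \<inter> ball h e"] conjI ballI impI)
    show "openin (top_of_set \<Omega>) (\<Omega> \<inter> ball h e)" by (rule openin_open_Int) (rule open_ball)
    show "h \<in> \<Omega> \<inter> ball h e" using h e(1) by simp
    fix x y assume "x \<in> \<Omega> \<inter> ball h e" "y \<in> \<Omega> \<inter> ball h e" "small_on_zeros u c (hinf_apply x)"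
    then show "small_on_zeros u c (hinf_apply y)" using e(2)[of x] e(2)[of y] by simp
  qed
qed

section \<open>Comparison with a power of the inner function\<close>

lemma inner_radial_norm:
  assumes "inner_function u"
  shows "AE t in lebesgue_on {0..2 * pi}. ((\<lambda>r. norm (u (of_real r * cis t))) \<longlongrightarrow> 1) (at_left 1)"
proof -
  have "AE t in lebesgue_on {0..2 * pi}. \<exists>w. norm w = 1 \<and> ((\<lambda>r. u (of_real r * cis t)) \<longlongrightarrow> w) (at_left 1)"
    using assms by (simp add: inner_function_def)
  then show ?thesis by eventually_elim (metis tendsto_norm)
qed

text \<open>An annulus is connected, and on it \<open>norm u\<close> takes values below
  \<open>v\<close> (as \<open>u\<close> is not a finite Blaschke product) and above \<open>v\<close>
  (along a radius with limit 1).\<close>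

lemma inner_attains_value_near_boundary:
  assumes inner: "inner_function u" and nfb: "\<not> finite_blaschke_product u"
    and r: "r < 1" and v: "0 < v" "v < 1"
  obtains z where "r < norm z" "norm z < 1" "norm (u z) = v"
proof -
  obtain x where x: "r < norm x" "norm x < 1" "norm (u x) < v"
    using inner_small_near_boundary[OF inner nfb r v(1)] by blast
  have "\<exists>t. ((\<lambda>r. norm (u (of_real r * cis t))) \<longlongrightarrow> 1) (at_left 1)"
  proof (rule ccontr)
    assume "\<not> ?thesis"
    then have "AE t in lebesgue_on {0..2 * pi}. False"
      using inner_radial_norm[OF inner] by auto
    then obtain N where N: "{t \<in> space (lebesgue_on {0..2 * pi}). \<not> False} \<subseteq> N"
      "emeasure (lebesgue_on {0..2 * pi}) N = 0" "N \<in> sets (lebesgue_on {0..2 * pi})"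
      by (rule AE_E)
    then have "N = {0..2 * pi}" using sets.sets_into_space[OF N(3)] by auto
    then show False using N(2) by (simp add: emeasure_restrict_space)
  qed
  then obtain t where "((\<lambda>r. norm (u (of_real r * cis t))) \<longlongrightarrow> 1) (at_left 1)" ..
  then have "\<forall>\<^sub>F s in at_left 1. v < norm (u (of_real s * cis t))"
    by (rule order_tendstoD) (use v in simp)
  then have "\<forall>\<^sub>F s in at_left 1. v < norm (u (of_real s * cis t)) \<and> max 0 r < s \<and> s < 1"
    using eventually_radial_in_disc[OF r] by eventually_elim simp
  then obtain s where s: "v < norm (u (of_real s * cis t))" "max 0 r < s" "s < 1"
    using eventually_happens'[of "at_left (1::real)"] by (auto simp: trivial_limit_at_left_real)
  define A where "A = {z::complex. r < norm (z - 0) \<and> norm (z - 0) < 1}"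
  have "connected ((\<lambda>z. norm (u z)) ` A)"
  proof (rule connected_continuous_image)
    have "continuous_on (ball 0 1) u"
      using inner by (auto simp: inner_function_def intro: holomorphic_on_imp_continuous_on)
    then show "continuous_on A (\<lambda>z. norm (u z))"
      by (intro continuous_on_norm) (auto elim!: continuous_on_subset simp: A_def)
    show "connected A" unfolding A_def by (rule connected_annulus) simp
  qed
  then have "v \<in> (\<lambda>z. norm (u z)) ` A"
  proof (rule connectedD_interval)
    show "norm (u x) \<in> (\<lambda>z. norm (u z)) ` A" using x by (intro imageI) (simp add: A_def)
    show "norm (u (of_real s * cis t)) \<in> (\<lambda>z. norm (u z)) ` A"
      using s by (intro imageI) (simp add: A_def norm_mult)
  qed (use x s in simp_all)
  then obtain z where "z \<in> A" "norm (u z) = v" by blast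
  then show thesis using that[of z] by (simp add: A_def)
qed

text \<open>If \<open>norm (f z)\<close> were below \<open>d / 2\<close>, a zero of \<open>f\<close>
  would lie in the Whitney disc of \<open>z\<close>. There \<open>norm u < c / 2\<close>, and the
  small oscillation of \<open>u\<close> would force \<open>norm (u z) < c\<close>.\<close>

lemma bounded_below_off_zeros:
  assumes u: "little_bloch u" and small: "small_on_zeros u 0 f" and hol: "f holomorphic_on ball 0 1"
    and low: "circle_bounded_below f d" and d: "d > 0" and c: "c > 0"
  obtains r where "0 < r" "r < 1"
    "\<And>z. r \<le> norm z \<Longrightarrow> norm z < 1 \<Longrightarrow> c \<le> norm (u z) \<Longrightarrow> d / 2 \<le> norm (f z)"
proof -
  obtain r1 where r1: "r1 < 1"
    "\<And>a. r1 < norm a \<Longrightarrow> norm a < 1 \<Longrightarrow> f a = 0 \<Longrightarrow> norm (u a) < c / 2"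
    using small half_gt_zero[OF c] unfolding small_on_zeros_def by blast
  obtain r2 where r2: "r2 < 1"
    "\<And>a z. r2 < norm a \<Longrightarrow> norm a < 1 \<Longrightarrow> norm (z - a) \<le> (1 - norm a) / 2 \<Longrightarrow> norm (u z - u a) \<le> c / 2"
    using little_bloch_whitney[OF u half_gt_zero[OF c]] by auto
  define m where "m = max 0 (max r2 ((2 * r1 + 1) / 3))"
  have m: "0 \<le> m" "m < 1" "r2 \<le> m" "(2 * r1 + 1) / 3 \<le> m" using r1(1) r2(1) by (simp_all add: m_def le_max_iff_disj)
  show thesis
  \<comment> \<open>A radius strictly above \<open>m\<close> turns the nonstrict condition on
    \<open>norm z\<close> into the strict ones needed.\<close>
  proof (rule that[of "(1 + m) / 2"])
    fix z assume z: "(1 + m) / 2 \<le> norm z" "norm z < 1" "c \<le> norm (u z)"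
    show "d / 2 \<le> norm (f z)"
    proof (rule ccontr)
      assume "\<not> d / 2 \<le> norm (f z)"
      then have fz: "norm (f z) < d / 2" by simp
      obtain a where a: "norm (a - z) \<le> (1 - norm z) / 2" "f a = 0"
        by (rule circle_bounded_below_zero[OF low hol _ _ _ z(2) fz]) (use d in auto)
      have "\<bar>norm a - norm z\<bar> \<le> (1 - norm z) / 2"
        using a(1) norm_triangle_ineq3[of a z] by simp
      then have "r1 < norm a" "norm a < 1" using z m by argo+
      then have "norm (u a) < c / 2" using r1 a by blast
      moreover have "norm (u a - u z) \<le> c / 2" using r2 a z m by simp
      ultimately show False using z(3) norm_triangle_ineq2[of "u z" "u a"]
        by (simp add: norm_minus_commute)
    qed
  qed (use m in auto)
qed

text \<open>The maximum principle gives \<open>norm E \<le> 1\<close> at a point near the circle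
  with \<open>norm u = 1/8\<close>. This bounds \<open>norm f\<close> there from below by more than
  the permitted 3/16.\<close>

lemma little_bloch_approximation_contradiction:
  assumes inner: "inner_function u" and lb: "little_bloch u" and nfb: "\<not> finite_blaschke_product u"
    and f: "f holomorphic_on ball 0 1" and low: "circle_bounded_below f d" and d: "d > 0"
    and small: "small_on_zeros u 0 f"
    and close: "\<And>z. norm z < 1 \<Longrightarrow> \<bar>norm (u z) - norm (f z)\<bar> < 1/16"
  shows False
proof -
  have u: "u holomorphic_on ball 0 1" using inner by (simp add: inner_function_def)
  have contu: "continuous_on (ball 0 1) u"
    by (intro holomorphic_on_imp_continuous_on u)
  \<comment> \<open>The cap 1/4 makes \<open>c < 1/8\<close>, so that points near the circle with
    \<open>norm u = 1/8\<close> belong to the region \<open>A\<close> below.\<close>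
  define \<delta> where "\<delta> = min (d / 2) (1/4)"
  have \<delta>: "0 < \<delta>" "\<delta> \<le> 1/4" "\<delta> \<le> d / 2" using d by (auto simp: \<delta>_def)
  define c where "c = \<delta> ^ 4 / 2"
  have c0: "0 < c" using \<delta> by (simp add: c_def)
  have "\<delta> ^ 4 \<le> (1/4) ^ 4" using \<delta> by (intro power_mono) auto
  then have c8: "c < 1/8" by (simp add: c_def power4_eq_xxxx)
  obtain r where r: "0 < r" "r < 1"
    and fd: "\<And>z. r \<le> norm z \<Longrightarrow> norm z < 1 \<Longrightarrow> c \<le> norm (u z) \<Longrightarrow> d / 2 \<le> norm (f z)"
    using bounded_below_off_zeros[OF lb small f low d c0] by blast
  have f\<delta>: "\<delta> \<le> norm (f z)" if "r \<le> norm z" "norm z < 1" "c \<le> norm (u z)" for z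
    using fd[OF that] \<delta> by linarith
  obtain m where m: "r ^ m < \<delta> ^ 4"
    using real_arch_pow_inv[of "\<delta> ^ 4" r] \<delta> r by auto
  \<comment> \<open>Up to a factor 4, \<open>log |E|\<close> compares \<open>- log |f|\<close> with \<open>- log |u| / 4\<close>; the choice of \<open>c\<close>
     makes it nonpositive where \<open>|u| = c\<close>, and \<open>z ^ m\<close> does the same on the inner circle.\<close>
  define E where "E = (\<lambda>z. 2 * (7/16) ^ 4 * u z * z ^ m / f z ^ 4)"
  have normE: "norm (E z) = 2 * (7/16) ^ 4 * norm (u z) * norm z ^ m / norm (f z) ^ 4" for z
    by (simp add: E_def norm_mult norm_divide norm_power)
  define A where "A = {z \<in> ball 0 1. r \<le> norm z \<and> c \<le> norm (u z) \<and> norm (u z) \<le> 1/2}"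
  define W where "W = {z \<in> ball 0 1. r < norm z \<and> c < norm (u z) \<and> norm (u z) < 1/2}"
  have WA: "W \<subseteq> A" "A \<subseteq> ball 0 1" by (auto simp: A_def W_def)
  have fA: "\<delta> \<le> norm (f z)" if "z \<in> A" for z using f\<delta>[of z] that by (simp add: A_def)
  have fA0: "f z \<noteq> 0" if "z \<in> A" for z using fA[OF that] \<delta> by auto
  have EA: "norm (E z) \<le> 2 * (7/16) ^ 4 * norm (u z) * norm z ^ m / \<delta> ^ 4" if "z \<in> A" for z
    unfolding normE using fA[OF that] \<delta> by (intro divide_left_mono power_mono mult_pos_pos zero_less_power) auto
  have zm: "norm z ^ m \<le> 1" if "norm z < 1" for z :: complex
    using that by (simp add: power_le_one)
  \<comment> \<open>This covers the part of the boundary inside the disc. The unit circle is handled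
    separately by radial limits.\<close>
  have bdry: "norm (E z) \<le> 1" if z: "z \<in> A" "z \<notin> W" for z
  proof -
    have z1: "norm z < 1" using z by (simp add: A_def)
    consider "norm (u z) = 1/2" | "norm (u z) = c" | "norm z = r"
      using z by (force simp: A_def W_def)
    then show ?thesis
    proof cases
      case 1
      then have "7/16 \<le> norm (f z)" using close[OF z1] by linarith
      then have "(7/16) ^ 4 \<le> norm (f z) ^ 4" by (intro power_mono) auto
      moreover have "norm (E z) \<le> (7/16) ^ 4 / norm (f z) ^ 4"
        unfolding normE 1 using zm[OF z1] by (intro divide_right_mono) auto
      ultimately show ?thesis
        using fA0[OF z(1)] by (smt (verit) divide_le_eq_1_pos zero_less_norm_iff zero_less_power)
    next
      case 2
      have "2 * (7/16) ^ 4 * c * norm z ^ m \<le> 2 * 1 * c * 1"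
        using zm[OF z1] c0 by (intro mult_mono) (auto simp: power4_eq_xxxx)
      then have "2 * (7/16) ^ 4 * c * norm z ^ m / \<delta> ^ 4 \<le> 1"
        using \<delta>(1) by (simp add: c_def divide_le_eq)
      with EA[OF z(1)] show ?thesis unfolding 2 by (rule order_trans)
    next
      case 3
      have "2 * (7/16) ^ 4 * norm (u z) * r ^ m \<le> 2 * 1 * (1/2) * \<delta> ^ 4"
        using m r z by (intro mult_mono) (auto simp: power4_eq_xxxx A_def)
      then have "2 * (7/16) ^ 4 * norm (u z) * r ^ m / \<delta> ^ 4 \<le> 1"
        using \<delta>(1) by (simp add: divide_le_eq)
      with EA[OF z(1)] show ?thesis unfolding 3 by (rule order_trans)
    qed
  qed
  have EM: "norm (E z) \<le> 1 / \<delta> ^ 4" if z: "z \<in> A" for z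
  proof -
    have "2 * (7/16) ^ 4 * norm (u z) * norm z ^ m \<le> 2 * 1 * (1/2) * 1"
      using z zm[of z] by (intro mult_mono) (auto simp: power4_eq_xxxx A_def)
    then have "2 * (7/16) ^ 4 * norm (u z) * norm z ^ m / \<delta> ^ 4 \<le> 1 / \<delta> ^ 4"
      using \<delta> by (intro divide_right_mono) auto
    with EA[OF z] show ?thesis by (rule order_trans)
  qed
  \<comment> \<open>The positive part of \<open>norm E - 1\<close>, extended by 0. By
    \<open>bdry\<close> it already vanishes on \<open>A - W\<close>, so the extension is continuous
    on the disc.\<close>
  define S where "S = (\<lambda>z. if z \<in> A then max 1 (norm (E z)) - 1 else 0)"
  have S_out: "S z = 0" if "z \<notin> W" for z
    using bdry[OF _ that] by (auto simp: S_def)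
  have clA: "closedin (top_of_set (ball 0 1)) A"
  proof -
    have "closedin (top_of_set (ball 0 1)) (ball 0 1 \<inter> (\<lambda>z. (norm z, norm (u z))) -` ({r..} \<times> {c..1/2}))"
      by (intro continuous_closedin_preimage continuous_intros contu closed_Times)
    also have "ball 0 1 \<inter> (\<lambda>z. (norm z, norm (u z))) -` ({r..} \<times> {c..1/2}) = A"
      by (auto simp: A_def)
    finally show ?thesis .
  qed
  have opW: "open W"
  proof -
    have "open (ball 0 1 \<inter> (\<lambda>z. (norm z, norm (u z))) -` ({r<..} \<times> {c<..<1/2}))"
      by (intro continuous_open_preimage continuous_intros contu open_Times; simp)
    also have "ball 0 1 \<inter> (\<lambda>z. (norm z, norm (u z))) -` ({r<..} \<times> {c<..<1/2}) = W"
      by (auto simp: W_def)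
    finally show ?thesis .
  qed
  have holE: "E holomorphic_on T" if "T \<subseteq> A" for T
    unfolding E_def using that WA
    by (intro holomorphic_intros holomorphic_on_subset[OF u] holomorphic_on_subset[OF f])
       (auto dest: fA0)
  have contS: "continuous_on (ball 0 1) S"
  proof -
    have "continuous_on (A \<union> (ball 0 1 - W)) S"
      unfolding S_def
    proof (rule continuous_on_cases_local)
      have eq: "A \<union> (ball 0 1 - W) = ball 0 1" using WA by auto
      show "closedin (top_of_set (A \<union> (ball 0 1 - W))) A" unfolding eq by (rule clA)
      show "closedin (top_of_set (A \<union> (ball 0 1 - W))) (ball 0 1 - W)"
        unfolding eq using opW WA by (intro closedin_diff) (auto simp: openin_open_eq)
      have "continuous_on A f" "continuous_on A u"
        using WA f u by (meson continuous_on_subset holomorphic_on_imp_continuous_on)+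
      then show "continuous_on A (\<lambda>z. max 1 (norm (E z)) - 1)"
        unfolding E_def by (intro continuous_intros) (auto dest: fA0)
      fix x assume "x \<in> A \<and> x \<notin> A \<or> x \<in> ball 0 1 - W \<and> x \<in> A"
      then show "max 1 (norm (E x)) - 1 = 0" using bdry[of x] by auto
    qed auto
    then show ?thesis by (rule continuous_on_subset) (use WA in auto)
  qed
  have "touching_subharmonic W (\<lambda>z. max 1 (norm (E z)) - 1)"
    by (rule touching_subharmonic_max_norm[OF holE[OF WA(1)] opW])
  then have SW: "touching_subharmonic W S"
    by (rule touching_subharmonic_eq) (use WA in \<open>auto simp: S_def\<close>)
  have S: "touching_subharmonic (ball 0 1) S"
    by (rule touching_subharmonic_glue[OF S_out _ contS SW]) (use WA in \<open>auto simp: S_def\<close>)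
  have S0: "S z = 0" if "norm z < 1" for z
  proof (rule touching_subharmonic_radial_zero[OF S _ _ _ that])
    show "0 \<le> S z" for z by (simp add: S_def)
    show "S z \<le> 1 / \<delta> ^ 4" for z using EM[of z] \<delta> by (auto simp: S_def max_def)
    show "AE t in lebesgue_on {0..2 * pi}. ((\<lambda>r. S (of_real r * cis t)) \<longlongrightarrow> 0) (at_left 1)"
      using inner_radial_norm[OF inner]
    proof eventually_elim
      case (elim t)
      \<comment> \<open>Along almost every radius \<open>norm u\<close> eventually exceeds 1/2, so
        the radius leaves \<open>A\<close> and \<open>S\<close> becomes 0.\<close>
      have "\<forall>\<^sub>F s in at_left 1. 1/2 < norm (u (of_real s * cis t))"
        using elim by (rule order_tendstoD) simp
      then have "\<forall>\<^sub>F s in at_left 1. S (of_real s * cis t) = 0"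
        by eventually_elim (simp add: S_def A_def)
      then show ?case by (rule tendsto_eventually)
    qed
  qed
  \<comment> \<open>Close enough to the circle for Bernoulli's inequality to give
    \<open>norm x ^ m \<ge> 1/2\<close>, which neutralises the auxiliary factor
    \<open>z ^ m\<close>.\<close>
  define q where "q = max r (1 - 1 / (2 * (real m + 1)))"
  have q: "q < 1" "r \<le> q" "1 - 1 / (2 * (real m + 1)) \<le> q" using r by (auto simp: q_def)
  obtain x where x: "q < norm x" "norm x < 1" "norm (u x) = 1/8"
    using inner_attains_value_near_boundary[OF inner nfb q(1), of "1/8"] by auto
  have xA: "x \<in> A" using x q c8 by (simp add: A_def)
  then have "norm (E x) \<le> 1" using S0[OF x(2)] by (simp add: S_def)
  then have E1: "2 * (7/16) ^ 4 * (1/8) * norm x ^ m \<le> norm (f x) ^ 4"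
    using fA0[OF xA] unfolding normE x(3) by (simp add: divide_le_eq)
  have "norm (f x) \<le> 3/16" using close[OF x(2)] x(3) by linarith
  then have f4: "norm (f x) ^ 4 \<le> (3/16) ^ 4" by (intro power_mono) auto
  have "1/2 \<le> norm x ^ m"
  proof -
    have "1/2 \<le> 1 + real m * (- (1 / (2 * (real m + 1))))" by (simp add: field_simps)
    also have "\<dots> \<le> (1 + (- (1 / (2 * (real m + 1))))) ^ m"
      by (rule Bernoulli_inequality) (simp add: field_simps)
    also have "\<dots> \<le> norm x ^ m"
    proof (rule power_mono)
      show "1 + - (1 / (2 * (real m + 1))) \<le> norm x" using x(1) q(3) by linarith
    qed (simp add: field_simps)
    finally show ?thesis .
  qed
  then have "2 * (7/16) ^ 4 * (1/8) * (1/2) \<le> 2 * (7/16) ^ 4 * (1/8) * norm x ^ m"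
    by (intro mult_left_mono) auto
  with E1 f4 have "2 * (7/16) ^ 4 * (1/8) * (1/2) \<le> (3/16 :: real) ^ 4" by linarith
  \<comment> \<open>After multiplication by \<open>16 ^ 4\<close> the claim reads
    \<open>7 ^ 4 / 8 \<le> 3 ^ 4\<close>, that is, about 300 against 81.\<close>
  then show False by (simp add: power4_eq_xxxx)
qed

theorem theorem2p10:
  fixes u :: hinf and \<Omega> :: "hinf set"
  assumes "inner_function (hinf_apply u)"
    and "little_bloch (hinf_apply u)"
    and "\<not> finite_blaschke_product (hinf_apply u)"
    and "\<Omega> \<in> components CNstar"
  shows "\<not> (\<forall>\<epsilon>>0. \<exists>f\<in>\<Omega>. \<forall>z\<in>unit_disc. \<bar>norm (hinf_apply u z) - norm (hinf_apply f z)\<bar> < \<epsilon>)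
    \<and> u \<notin> closure \<Omega>"
proof -
  have main: "\<not> (\<forall>\<epsilon>>0. \<exists>f\<in>\<Omega>. \<forall>z\<in>unit_disc. \<bar>norm (hinf_apply u z) - norm (hinf_apply f z)\<bar> < \<epsilon>)"
  proof
    assume approx: "\<forall>\<epsilon>>0. \<exists>f\<in>\<Omega>. \<forall>z\<in>unit_disc. \<bar>norm (hinf_apply u z) - norm (hinf_apply f z)\<bar> < \<epsilon>"
    \<comment> \<open>The tolerance 1/16 yields the numbers 7/16 = 1/2 - 1/16 and 3/16 = 1/8 + 1/16
      of the comparison argument.\<close>
    then obtain f where f: "f \<in> \<Omega>"
      "\<And>z. z \<in> unit_disc \<Longrightarrow> \<bar>norm (hinf_apply u z) - norm (hinf_apply f z)\<bar> < 1/16"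
      by (meson zero_less_divide_1_iff zero_less_numeral)
    have "small_on_zeros (hinf_apply u) 0 (hinf_apply f)"
      unfolding small_on_zeros_def
    proof (intro allI impI)
      fix c :: real assume c: "0 < c"
      then obtain g where g: "g \<in> \<Omega>"
        "\<And>z. z \<in> unit_disc \<Longrightarrow> \<bar>norm (hinf_apply u z) - norm (hinf_apply g z)\<bar> < c / 2"
        using approx half_gt_zero by meson
      \<comment> \<open>At a zero of \<open>g\<close> the approximation gives
        \<open>norm u < c / 2\<close> directly. The component then carries this to the fixed
        \<open>f\<close>, for every \<open>c\<close>.\<close>
      have "small_on_zeros (hinf_apply u) (c / 2) (hinf_apply g)"
        unfolding small_on_zeros_def
      proof (intro allI impI exI[of _ 0] conjI)
        fix c' a assume "c / 2 < c'" "0 < norm a \<and> norm a < 1 \<and> hinf_apply g a = 0"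
        then show "norm (hinf_apply u a) < c'" using g(2)[of a] by simp
      qed simp
      then have "small_on_zeros (hinf_apply u) (c / 2) (hinf_apply f)"
        by (rule small_on_zeros_component[OF assms(2,4) g(1) f(1)])
      then show "\<exists>r<1. \<forall>a. r < norm a \<and> norm a < 1 \<and> hinf_apply f a = 0 \<longrightarrow> norm (hinf_apply u a) < c"
        using c unfolding small_on_zeros_def by simp
    qed
    moreover have "f \<in> CNstar" using f(1) in_components_subset[OF assms(4)] by blast
    then obtain d where "d > 0" "circle_bounded_below (hinf_apply f) d"
      using CNstar_circle_bounded_below by blast
    ultimately show False
      using little_bloch_approximation_contradiction[OF assms(1-3) hinf_holomorphic[of f]] f(2) by auto
  qed
  moreover have "u \<notin> closure \<Omega>"
  proof
    assume u: "u \<in> closure \<Omega>"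
    have "\<exists>f\<in>\<Omega>. \<forall>z\<in>unit_disc. \<bar>norm (hinf_apply u z) - norm (hinf_apply f z)\<bar> < \<epsilon>"
      if \<epsilon>: "\<epsilon> > 0" for \<epsilon>
    proof -
      obtain f where f: "f \<in> \<Omega>" "dist f u < \<epsilon>" using u \<epsilon> unfolding closure_approachable by blast
      have "\<bar>norm (hinf_apply u z) - norm (hinf_apply f z)\<bar> < \<epsilon>" if z: "z \<in> unit_disc" for z
        using norm_triangle_ineq3[of "hinf_apply u z" "hinf_apply f z"]
          norm_hinf_upper[OF z, of "f - u"] f(2)
        by (simp add: dist_norm norm_minus_commute)
      with f(1) show ?thesis by blast
    qed
    with main show False by blast
  qed
  ultimately show ?thesis by blast
qed

end
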